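(* Let $[0,\tau]$ and $[0,\mu]$ be Presburger truncated ordered abelian groups (as defined in the context), regarded as structures in the language $\{\le,0,\tau,+,1\}$ (with $\tau$, resp. $\mu$, interpreting the constant for the top element). Let $\tau-1$ denote the penultimate element of $[0,\tau]$, i.e. its predecessor $\tau-1$ computed in an ambient model of Presburger arithmetic of which $[0,\tau]$ is a truncation, and similarly $\mu-1$. If (A) $\tau-1\in\{0,1,2,\dots\}$ (i.e. equals $1+\dots+1$ for some number of summands) if and only if $\mu-1\in\{0,1,2,\dots\}$, and in that case they equal the same natural number, and (B) for every positive integer $n$, $\tau-1$ and $\mu-1$ have the same remainder modulo $n$, then $[0,\tau]$ and $[0,\mu]$ are elementarily equivalent. That is, the elementary theory of a Presburger truncated ordered abelian group $[0,\tau]$ is determined by the Presburger $1$-type of $\tau-1$. Moreover, for every complete $1$-type $p(x)$ of Presburger arithmetic containing the formula $x\ge 0$, there is a Presburger truncated ordered abelian group $[0,\tau]$ such that $\tau-1$ realizes $p$.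
   Context: A truncated ordered abelian group (TOAG) is a linearly ordered set $([0,\tau],\le)$ with least element $0$ and greatest element $\tau$ and a binary operation $+$ satisfying a list of first-order axioms (commutativity, associativity, $x+0=x$, $x+\tau=\tau$, monotonicity, and cancellation/complementation axioms); every initial segment $[0,\tau_\Gamma]$ of the non-negative part of an ordered abelian group $\Gamma$, with truncated addition $a+b=\min(a\oplus b,\tau_\Gamma)$, is a TOAG. Presburger arithmetic is the first-order theory of $(\mathbb{Z},+,-,\le,0,1)$ in the language of ordered groups with a constant $1$ (the least positive element). A Presburger truncated ordered abelian group is a structure $([0,\tau],\le,+,0,\tau,1)$ isomorphic to a truncation $[0,\tau_M]=\{g\in M:0\le g\le\tau_M\}$ of a model $M$ of Presburger arithmetic, with $\tau_M\ge 0$, the induced order, truncated addition $a+b=\min(a+_M b,\tau_M)$, and $1$ the least positive element of $M$ (it is not required that $1<\tau$). In a model of Presburger arithmetic, the complete $1$-type of an element $x\ge 0$ is determined by whether $x$ is a standard natural number (and which one) and by its residue modulo each positive integer $n$. *)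

theory Defs
  imports Main
begin

text \<open>
  First-order formulas with equality over a language whose only relation symbol is
  \<open>\<le>\<close>.  The parameter \<open>'t\<close> is the type of terms of the language; the two languages
  below differ only in their terms.  Variables are named by natural numbers, and the
  remaining connectives and the universal quantifier are definable.
\<close>

datatype 't fm =
    Eq 't 't
  | Le 't 't
  | Neg "'t fm"
  | Conj "'t fm" "'t fm"
  | Ex nat "'t fm"

primrec fv_fm :: "('t \<Rightarrow> nat set) \<Rightarrow> 't fm \<Rightarrow> nat set" where
  "fv_fm fv (Eq s t) = fv s \<union> fv t"
| "fv_fm fv (Le s t) = fv s \<union> fv t"
| "fv_fm fv (Neg \<phi>) = fv_fm fv \<phi>"
| "fv_fm fv (Conj \<phi> \<psi>) = fv_fm fv \<phi> \<union> fv_fm fv \<psi>"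
| "fv_fm fv (Ex x \<phi>) = fv_fm fv \<phi> - {x}"

primrec sat_fm ::
  "'a set \<Rightarrow> ('a \<Rightarrow> 'a \<Rightarrow> bool) \<Rightarrow> ((nat \<Rightarrow> 'a) \<Rightarrow> 't \<Rightarrow> 'a) \<Rightarrow> (nat \<Rightarrow> 'a) \<Rightarrow> 't fm \<Rightarrow> bool"
where
  "sat_fm A le ev e (Eq s t) \<longleftrightarrow> ev e s = ev e t"
| "sat_fm A le ev e (Le s t) \<longleftrightarrow> le (ev e s) (ev e t)"
| "sat_fm A le ev e (Neg \<phi>) \<longleftrightarrow> \<not> sat_fm A le ev e \<phi>"
| "sat_fm A le ev e (Conj \<phi> \<psi>) \<longleftrightarrow> sat_fm A le ev e \<phi> \<and> sat_fm A le ev e \<psi>"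
| "sat_fm A le ev e (Ex x \<phi>) \<longleftrightarrow> (\<exists>a\<in>A. sat_fm A le ev (e(x := a)) \<phi>)"

text \<open>
  Structures.  The values of the components outside the carrier are irrelevant.
\<close>

record 'a ostr =
  carrier :: "'a set"
  le :: "'a \<Rightarrow> 'a \<Rightarrow> bool"
  zero :: 'a
  one :: 'a
  add :: "'a \<Rightarrow> 'a \<Rightarrow> 'a"

record 'a gstr = "'a ostr" +
  neg :: "'a \<Rightarrow> 'a"

record 'a tstr = "'a ostr" +
  tau :: 'a

definition is_gstr :: "'a gstr \<Rightarrow> bool" where
  "is_gstr M \<longleftrightarrow>
     zero M \<in> carrier M \<and> one M \<in> carrier M \<and>
     (\<forall>a\<in>carrier M. \<forall>b\<in>carrier M. add M a b \<in> carrier M) \<and>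
     (\<forall>a\<in>carrier M. neg M a \<in> carrier M)"

definition is_tstr :: "'a tstr \<Rightarrow> bool" where
  "is_tstr S \<longleftrightarrow>
     zero S \<in> carrier S \<and> one S \<in> carrier S \<and> tau S \<in> carrier S \<and>
     (\<forall>a\<in>carrier S. \<forall>b\<in>carrier S. add S a b \<in> carrier S)"


subsection \<open>Presburger arithmetic\<close>

datatype gtm = GVar nat | GZero | GOne | GAdd gtm gtm | GNeg gtm

primrec fv_gtm :: "gtm \<Rightarrow> nat set" where
  "fv_gtm (GVar x) = {x}"
| "fv_gtm GZero = {}"
| "fv_gtm GOne = {}"
| "fv_gtm (GAdd s t) = fv_gtm s \<union> fv_gtm t"
| "fv_gtm (GNeg s) = fv_gtm s"

primrec eval_gtm :: "'a gstr \<Rightarrow> (nat \<Rightarrow> 'a) \<Rightarrow> gtm \<Rightarrow> 'a" where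
  "eval_gtm M e (GVar x) = e x"
| "eval_gtm M e GZero = zero M"
| "eval_gtm M e GOne = one M"
| "eval_gtm M e (GAdd s t) = add M (eval_gtm M e s) (eval_gtm M e t)"
| "eval_gtm M e (GNeg s) = neg M (eval_gtm M e s)"

definition gsat :: "'a gstr \<Rightarrow> (nat \<Rightarrow> 'a) \<Rightarrow> gtm fm \<Rightarrow> bool" where
  "gsat M = sat_fm (carrier M) (le M) (eval_gtm M)"

definition gtrue :: "'a gstr \<Rightarrow> gtm fm \<Rightarrow> bool" where
  "gtrue M \<phi> \<longleftrightarrow> (\<forall>e. range e \<subseteq> carrier M \<longrightarrow> gsat M e \<phi>)"

definition int_gstr :: "int gstr" where
  "int_gstr =
     \<lparr>carrier = UNIV, le = (\<le>), zero = 0, one = 1, add = (+), neg = uminus\<rparr>"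

definition presburger :: "gtm fm set" where
  "presburger = {\<phi>. fv_fm fv_gtm \<phi> = {} \<and> gtrue int_gstr \<phi>}"

definition presburger_model :: "'a gstr \<Rightarrow> bool" where
  "presburger_model M \<longleftrightarrow> is_gstr M \<and> (\<forall>\<phi>\<in>presburger. gtrue M \<phi>)"

primrec mult :: "('a, 'z) ostr_scheme \<Rightarrow> nat \<Rightarrow> 'a \<Rightarrow> 'a" where
  "mult M 0 x = zero M"
| "mult M (Suc n) x = add M x (mult M n x)"

definition has_remainder :: "'a gstr \<Rightarrow> 'a \<Rightarrow> nat \<Rightarrow> nat \<Rightarrow> bool" where
  "has_remainder M x n r \<longleftrightarrow>
     r < n \<and> (\<exists>q\<in>carrier M. x = add M (mult M n q) (mult M r (one M)))"

text \<open>
  Formulas in (at most) the free variable \<open>0\<close>, and the complete 1-type of an element.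
\<close>

definition fm1 :: "gtm fm set" where
  "fm1 = {\<phi>. fv_fm fv_gtm \<phi> \<subseteq> {0}}"

definition gsat1 :: "'a gstr \<Rightarrow> 'a \<Rightarrow> gtm fm \<Rightarrow> bool" where
  "gsat1 M a \<phi> \<longleftrightarrow> gsat M (\<lambda>_. a) \<phi>"

definition type_of :: "'a gstr \<Rightarrow> 'a \<Rightarrow> gtm fm set" where
  "type_of M a = {\<phi>\<in>fm1. gsat1 M a \<phi>}"

definition realizes :: "'a gstr \<Rightarrow> 'a \<Rightarrow> gtm fm set \<Rightarrow> bool" where
  "realizes M a p \<longleftrightarrow> a \<in> carrier M \<and> (\<forall>\<phi>\<in>p. gsat1 M a \<phi>)"

text \<open>
  A complete 1-type is a complete set of formulas in one variable every finite part
  \<open>F\<close> of which is consistent with the theory.  As \<open>presburger\<close> is the complete theory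
  of the integers, the latter means that some integer satisfies \<open>F\<close>.
\<close>

definition complete_1_type :: "gtm fm set \<Rightarrow> bool" where
  "complete_1_type p \<longleftrightarrow>
     p \<subseteq> fm1 \<and>
     (\<forall>F. finite F \<and> F \<subseteq> p \<longrightarrow> (\<exists>a. realizes int_gstr a F)) \<and>
     (\<forall>\<phi>\<in>fm1. \<phi> \<in> p \<or> Neg \<phi> \<in> p)"


subsection \<open>Truncations\<close>

datatype ttm = TVar nat | TZero | TOne | TTau | TAdd ttm ttm

primrec fv_ttm :: "ttm \<Rightarrow> nat set" where
  "fv_ttm (TVar x) = {x}"
| "fv_ttm TZero = {}"
| "fv_ttm TOne = {}"
| "fv_ttm TTau = {}"
| "fv_ttm (TAdd s t) = fv_ttm s \<union> fv_ttm t"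

primrec eval_ttm :: "'a tstr \<Rightarrow> (nat \<Rightarrow> 'a) \<Rightarrow> ttm \<Rightarrow> 'a" where
  "eval_ttm S e (TVar x) = e x"
| "eval_ttm S e TZero = zero S"
| "eval_ttm S e TOne = one S"
| "eval_ttm S e TTau = tau S"
| "eval_ttm S e (TAdd s t) = add S (eval_ttm S e s) (eval_ttm S e t)"

definition tsat :: "'a tstr \<Rightarrow> (nat \<Rightarrow> 'a) \<Rightarrow> ttm fm \<Rightarrow> bool" where
  "tsat S = sat_fm (carrier S) (le S) (eval_ttm S)"

definition ttrue :: "'a tstr \<Rightarrow> ttm fm \<Rightarrow> bool" where
  "ttrue S \<phi> \<longleftrightarrow> (\<forall>e. range e \<subseteq> carrier S \<longrightarrow> tsat S e \<phi>)"

definition elem_equiv :: "'a tstr \<Rightarrow> 'b tstr \<Rightarrow> bool" where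
  "elem_equiv S T \<longleftrightarrow> (\<forall>\<phi>. fv_fm fv_ttm \<phi> = {} \<longrightarrow> (ttrue S \<phi> \<longleftrightarrow> ttrue T \<phi>))"

definition truncation :: "'a gstr \<Rightarrow> 'a \<Rightarrow> 'a tstr" where
  "truncation M t =
     \<lparr>carrier = {g \<in> carrier M. le M (zero M) g \<and> le M g t},
      le = le M, zero = zero M, one = one M,
      add = (\<lambda>a b. if le M (add M a b) t then add M a b else t),
      tau = t\<rparr>"

definition tstr_iso :: "('a \<Rightarrow> 'b) \<Rightarrow> 'a tstr \<Rightarrow> 'b tstr \<Rightarrow> bool" where
  "tstr_iso f S T \<longleftrightarrow>
     bij_betw f (carrier S) (carrier T) \<and>
     (\<forall>a\<in>carrier S. \<forall>b\<in>carrier S. le S a b \<longleftrightarrow> le T (f a) (f b)) \<and>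
     (\<forall>a\<in>carrier S. \<forall>b\<in>carrier S. f (add S a b) = add T (f a) (f b)) \<and>
     f (zero S) = zero T \<and> f (one S) = one T \<and> f (tau S) = tau T"

text \<open>
  \<open>presburger_toag M t S\<close>: \<open>S\<close> is a Presburger truncated ordered abelian group, by way
  of an isomorphism with the truncation \<open>[0,t]\<close> of the model \<open>M\<close>.  Since \<open>S\<close> is a
  structure with a constant for \<open>1\<close>, the element \<open>1\<close> of \<open>M\<close> lies in \<open>[0,t]\<close>; this excludes
  \<open>t = 0\<close> (where there is no penultimate element either), but not \<open>t = 1\<close>.
\<close>

definition presburger_toag :: "'b gstr \<Rightarrow> 'b \<Rightarrow> 'a tstr \<Rightarrow> bool" where
  "presburger_toag M t S \<longleftrightarrow>
     presburger_model M \<and> t \<in> carrier M \<and> le M (zero M) t \<and>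
     is_tstr S \<and> (\<exists>f. tstr_iso f S (truncation M t))"

definition penult :: "'b gstr \<Rightarrow> 'b \<Rightarrow> 'b" where
  "penult M t = add M t (neg M (one M))"

end

theory Submission
  imports Defs Complex_Main "HOL-Library.Countable"
begin

text \<open>
  A truncation is interpreted in its ambient group, so everything rests on the elimination of
  quantifiers for Z-groups.  It is used in the form of a back-and-forth property: given finitely
  many atoms \<open>0 \<le> s\<close> and \<open>n | s\<close>, an element can be matched in another Z-group as soon as the
  parameters agree on finitely many further atoms (Cooper's virtual substitution).  Terms over a
  truncation take one of finitely many linear values, and which one is decided by such atoms.
  Hence the theory of \<open>[0,\<tau>]\<close> depends only on the atoms satisfied by \<open>\<tau> - 1\<close>, that is, on its
  type.  A type containing \<open>x \<ge> 0\<close> is a limit of integers \<open>z\<^sub>i\<close>.  Either these are eventually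
  constant, or the type is realized by \<open>X\<close> in the lexicographically ordered group of the
  polynomials \<open>q X + s\<close> over the rationals whose value at \<open>z\<^sub>i\<close> is eventually an integer.
\<close>

section \<open>Z-groups\<close>

text \<open>Quantifier elimination is obtained without rewriting formulas: two structures over
  different types are compared directly, and a formula is decided by a finite set of atoms chosen
  before the assignments. This finiteness serves twice. It survives a quantifier because finitely
  many test values \<open>s + i\<close> suffice, and it lets single integers approximate a
  realization of a type, since finitely many eventual statements about a sequence hold
  simultaneously. In a truncation the sum is only piecewise linear and quantifiers range over
  \<open>[0,t]\<close>; comparing values instead of translating formulas reduces the first obstacle
  to a finite case distinction and the second to two extra atoms. Clearing coefficients by a common
  multiple \<open>C\<close> means that a match \<open>b\<close> must solve \<open>C b = w\<close>,
  which is why divisibility atoms are carried along with the comparisons. Completeness of a type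
  makes every atom eventually true or eventually false along the integers that approximate it; this
  takes the place of an ultrafilter.\<close>

definition smul :: "('a, 'z) gstr_scheme \<Rightarrow> int \<Rightarrow> 'a \<Rightarrow> 'a" where
  "smul M k x = (if 0 \<le> k then mult M (nat k) x else neg M (mult M (nat (- k)) x))"

definition gdvd :: "'a gstr \<Rightarrow> int \<Rightarrow> 'a \<Rightarrow> bool" where
  "gdvd M n x \<longleftrightarrow> (\<exists>q\<in>carrier M. x = smul M n q)"

locale gstr_notation =
  fixes M :: "'a gstr"
begin

abbreviation plus (infixl "\<oplus>" 65) where "a \<oplus> b \<equiv> add M a b"
abbreviation less_eq (infix "\<preceq>" 50) where "a \<preceq> b \<equiv> le M a b"
abbreviation zer ("\<zero>") where "\<zero> \<equiv> zero M"
abbreviation on ("\<one>") where "\<one> \<equiv> one M"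
abbreviation minus ("\<ominus> _" [80] 80) where "\<ominus> a \<equiv> neg M a"
abbreviation scale (infixr "\<cdot>" 75) where "k \<cdot> a \<equiv> smul M k a"
abbreviation dv (infix "dvdg" 50) where "n dvdg x \<equiv> gdvd M n x"
abbreviation G where "G \<equiv> carrier M"

end

text \<open>Division is left to \<open>zgroup\<close>: in a model of Presburger arithmetic its
  integer remainder is found only after multiples, order and \<open>standard_below\<close> have been
  developed from the present axioms.\<close>

locale discrete_ordered_group = gstr_notation +
  assumes zero_closed [simp, intro]: "\<zero> \<in> G"
    and one_closed [simp, intro]: "\<one> \<in> G"
    and add_closed [simp, intro]: "a \<in> G \<Longrightarrow> b \<in> G \<Longrightarrow> a \<oplus> b \<in> G"
    and neg_closed [simp, intro]: "a \<in> G \<Longrightarrow> \<ominus> a \<in> G"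
    and add_assoc: "a \<in> G \<Longrightarrow> b \<in> G \<Longrightarrow> c \<in> G \<Longrightarrow> a \<oplus> b \<oplus> c = a \<oplus> (b \<oplus> c)"
    and add_comm: "a \<in> G \<Longrightarrow> b \<in> G \<Longrightarrow> a \<oplus> b = b \<oplus> a"
    and add_zero [simp]: "a \<in> G \<Longrightarrow> a \<oplus> \<zero> = a"
    and add_neg [simp]: "a \<in> G \<Longrightarrow> a \<oplus> \<ominus> a = \<zero>"
    and le_total: "a \<in> G \<Longrightarrow> b \<in> G \<Longrightarrow> a \<preceq> b \<or> b \<preceq> a"
    and le_antisym: "a \<in> G \<Longrightarrow> b \<in> G \<Longrightarrow> a \<preceq> b \<Longrightarrow> b \<preceq> a \<Longrightarrow> a = b"
    and le_trans: "a \<in> G \<Longrightarrow> b \<in> G \<Longrightarrow> c \<in> G \<Longrightarrow> a \<preceq> b \<Longrightarrow> b \<preceq> c \<Longrightarrow> a \<preceq> c"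
    and le_add: "a \<in> G \<Longrightarrow> b \<in> G \<Longrightarrow> c \<in> G \<Longrightarrow> a \<preceq> b \<Longrightarrow> a \<oplus> c \<preceq> b \<oplus> c"
    and zero_le_one: "\<zero> \<preceq> \<one>"
    and zero_neq_one: "\<zero> \<noteq> \<one>"
    and discrete: "a \<in> G \<Longrightarrow> \<zero> \<preceq> a \<Longrightarrow> a \<noteq> \<zero> \<Longrightarrow> \<one> \<preceq> a"
begin

lemma add_lcomm: "a \<in> G \<Longrightarrow> b \<in> G \<Longrightarrow> c \<in> G \<Longrightarrow> a \<oplus> (b \<oplus> c) = b \<oplus> (a \<oplus> c)"
  by (metis add_assoc add_comm)

lemmas add_ac = add_assoc add_comm add_lcomm

lemma zero_add [simp]: "a \<in> G \<Longrightarrow> \<zero> \<oplus> a = a"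
  by (metis add_comm add_zero zero_closed)

lemma neg_add_cancel [simp]: "a \<in> G \<Longrightarrow> b \<in> G \<Longrightarrow> a \<oplus> (\<ominus> a \<oplus> b) = b" "a \<in> G \<Longrightarrow> b \<in> G \<Longrightarrow> \<ominus> a \<oplus> (a \<oplus> b) = b"
  by (metis add_assoc add_comm add_neg neg_closed zero_add)+

lemma add_cancel: "a \<in> G \<Longrightarrow> b \<in> G \<Longrightarrow> c \<in> G \<Longrightarrow> a \<oplus> b = a \<oplus> c \<longleftrightarrow> b = c"
  by (metis neg_add_cancel(2))

lemma neg_unique: "a \<in> G \<Longrightarrow> b \<in> G \<Longrightarrow> a \<oplus> b = \<zero> \<Longrightarrow> \<ominus> a = b"
  by (metis add_cancel add_neg neg_closed)

lemma neg_neg [simp]: "a \<in> G \<Longrightarrow> \<ominus> \<ominus> a = a"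
  by (metis add_comm add_neg neg_closed neg_unique)

lemma neg_zero [simp]: "\<ominus> \<zero> = \<zero>"
  by (simp add: neg_unique)

lemma neg_add: "a \<in> G \<Longrightarrow> b \<in> G \<Longrightarrow> \<ominus> (a \<oplus> b) = \<ominus> a \<oplus> \<ominus> b"
  by (rule neg_unique) (simp_all add: add_ac)

section \<open>Integer multiples\<close>

lemma mult_closed [simp]: "x \<in> G \<Longrightarrow> mult M n x \<in> G"
  by (induction n) simp_all

lemma scale_closed [simp]: "x \<in> G \<Longrightarrow> k \<cdot> x \<in> G"
  by (simp add: smul_def)

lemma scale_0 [simp]: "0 \<cdot> x = \<zero>"
  by (simp add: smul_def)

lemma scale_succ: assumes "x \<in> G" shows "(k + 1) \<cdot> x = x \<oplus> k \<cdot> x"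
proof -
  have *: "k \<cdot> x = (if 0 \<le> k then mult M (nat k) x else \<ominus> (mult M (nat (- k)) x))" for k
    by (simp add: smul_def)
  consider "0 \<le> k" | n where "k = - int (Suc n)"
    by (metis int_cases of_nat_0_le_iff)
  then show ?thesis
  proof cases
    case 1
    then have "nat (k + 1) = Suc (nat k)" by simp
    with 1 show ?thesis by (simp add: *)
  next
    case 2
    then have "nat (- k) = Suc n" "nat (- (k + 1)) = n" by simp_all
    \<comment> \<open>For n = 0 the factor k + 1 is 0, where \<open>smul\<close> switches to its
      nonnegative branch.\<close>
    with 2 show ?thesis using assms by (cases "n = 0") (simp_all add: * neg_add)
  qed
qed

lemma scale_pred: assumes "x \<in> G" shows "(k - 1) \<cdot> x = \<ominus> x \<oplus> k \<cdot> x"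
  using scale_succ[OF assms, of "k - 1"] assms by simp

lemma scale_1 [simp]: "x \<in> G \<Longrightarrow> 1 \<cdot> x = x"
  using scale_succ[of x 0] by simp

lemma add_scale: "x \<in> G \<Longrightarrow> (k + l) \<cdot> x = k \<cdot> x \<oplus> l \<cdot> x"
proof (induction k rule: int_induct[where k = 0])
  case (step1 i)
  then show ?case using scale_succ[of x "i + l"] scale_succ[of x i] by (simp add: algebra_simps add_assoc)
next
  case (step2 i)
  have "i - 1 + l = i + l - 1" by simp
  with step2 show ?case using scale_pred[of x "i + l"] scale_pred[of x i] by (simp only:) (simp add: add_assoc)
qed simp

lemma scale_add: "x \<in> G \<Longrightarrow> y \<in> G \<Longrightarrow> k \<cdot> (x \<oplus> y) = k \<cdot> x \<oplus> k \<cdot> y"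
  by (induction k rule: int_induct[where k = 0]) (simp_all add: scale_succ scale_pred neg_add add_ac)

lemma scale_neg: "x \<in> G \<Longrightarrow> (- k) \<cdot> x = \<ominus> (k \<cdot> x)"
  using add_scale[of x k "- k"] by (intro neg_unique[symmetric]) simp_all

lemma scale_scale: "x \<in> G \<Longrightarrow> k \<cdot> l \<cdot> x = (k * l) \<cdot> x"
  by (induction k rule: int_induct[where k = 0])
    (simp_all add: scale_succ scale_pred add_scale distrib_right left_diff_distrib scale_neg
      diff_conv_add_uminus[of "_ * _"] add_comm del: diff_conv_add_uminus add_uminus_conv_diff)

lemma neg_scale: "x \<in> G \<Longrightarrow> \<ominus> x = (- 1) \<cdot> x"
  by (simp add: scale_neg)

lemma scale_minus: "x \<in> G \<Longrightarrow> k \<cdot> \<ominus> x = (- k) \<cdot> x"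
  unfolding neg_scale by (simp add: scale_scale)

lemma scale_zero [simp]: "k \<cdot> \<zero> = \<zero>"
  using scale_scale[of \<zero> k 0] by simp

section \<open>Order and discreteness\<close>

lemma le_refl [simp]: "a \<in> G \<Longrightarrow> a \<preceq> a"
  using le_total by blast

lemma le_iff: assumes "a \<in> G" "b \<in> G" shows "a \<preceq> b \<longleftrightarrow> \<zero> \<preceq> b \<oplus> \<ominus> a"
proof -
  have "b \<oplus> \<ominus> a \<oplus> a = b" using assms by (simp add: add_assoc add_comm[of "\<ominus> a"])
  then show ?thesis
    using le_add[of a b "\<ominus> a"] le_add[of \<zero> "b \<oplus> \<ominus> a" a] assms by auto
qed

lemma pos_add: "a \<in> G \<Longrightarrow> b \<in> G \<Longrightarrow> \<zero> \<preceq> a \<Longrightarrow> \<zero> \<preceq> b \<Longrightarrow> \<zero> \<preceq> a \<oplus> b"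
  using le_add[of \<zero> a b] le_trans[of \<zero> b "a \<oplus> b"] by simp

lemma pos_scale: assumes "a \<in> G" "\<zero> \<preceq> a" "0 \<le> k" shows "\<zero> \<preceq> k \<cdot> a"
  using assms(3) by (induction k rule: int_ge_induct) (simp_all add: assms scale_succ pos_add)

lemma pos_neg: assumes "a \<in> G" shows "\<zero> \<preceq> \<ominus> a \<longleftrightarrow> a = \<zero> \<or> \<not> \<zero> \<preceq> a"
  using assms le_iff[of a \<zero>] le_total[of \<zero> a] le_antisym[of \<zero> a] by auto

lemma one_pos [simp]: "\<not> \<zero> \<preceq> \<ominus> \<one>"
  using pos_neg zero_le_one zero_neq_one by simp

lemma not_pos: assumes "a \<in> G" shows "\<not> \<zero> \<preceq> a \<longleftrightarrow> \<zero> \<preceq> \<ominus> a \<oplus> \<ominus> \<one>"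
proof
  assume *: "\<not> \<zero> \<preceq> a"
  then have "\<zero> \<preceq> \<ominus> a" "\<ominus> a \<noteq> \<zero>" using assms pos_neg neg_neg neg_zero le_refl zero_closed by metis+
  then have "\<one> \<preceq> \<ominus> a" using discrete assms by simp
  then show "\<zero> \<preceq> \<ominus> a \<oplus> \<ominus> \<one>" using le_iff[of \<one> "\<ominus> a"] assms by simp
next
  assume *: "\<zero> \<preceq> \<ominus> a \<oplus> \<ominus> \<one>"
  show "\<not> \<zero> \<preceq> a"
  proof
    assume "\<zero> \<preceq> a"
    from pos_add[OF _ _ this *] assms show False by simp
  qed
qed

text \<open>A negative \<open>a\<close> satisfies \<open>- a - 1 >= 0\<close> by discreteness.
  Adding k times this to \<open>k a >= 0\<close> cancels \<open>a\<close> and leaves a negative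
  multiple of 1.\<close>

lemma pos_scale_iff: assumes "a \<in> G" "0 < k" shows "\<zero> \<preceq> k \<cdot> a \<longleftrightarrow> \<zero> \<preceq> a"
proof
  assume *: "\<zero> \<preceq> k \<cdot> a"
  show "\<zero> \<preceq> a"
  proof (rule ccontr)
    assume "\<not> \<zero> \<preceq> a"
    then have "\<zero> \<preceq> \<ominus> a \<oplus> \<ominus> \<one>" using not_pos assms by simp
    then have "\<zero> \<preceq> k \<cdot> (\<ominus> a \<oplus> \<ominus> \<one>)" by (rule pos_scale[rotated]) (use assms in simp_all)
    then have "\<zero> \<preceq> k \<cdot> a \<oplus> k \<cdot> (\<ominus> a \<oplus> \<ominus> \<one>)" using * assms by (intro pos_add) simp_all
    \<comment> \<open>This summand brings the sum \<open>- k\<close> to exactly \<open>- 1\<close>,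
      which \<open>one_pos\<close> refutes; signs of general multiples of 1 are only derived later,
      from this lemma.\<close>
    moreover have "\<zero> \<preceq> (k - 1) \<cdot> \<one>"
      using assms zero_le_one by (intro pos_scale) simp_all
    ultimately have "\<zero> \<preceq> k \<cdot> a \<oplus> k \<cdot> (\<ominus> a \<oplus> \<ominus> \<one>) \<oplus> (k - 1) \<cdot> \<one>"
      using assms by (intro pos_add[OF _ _ _ \<open>\<zero> \<preceq> (k - 1) \<cdot> \<one>\<close>]) simp_all
    also have "k \<cdot> a \<oplus> k \<cdot> (\<ominus> a \<oplus> \<ominus> \<one>) = (- k) \<cdot> \<one>"
      using assms by (simp add: scale_add scale_minus flip: add_scale add_assoc)
    also have "(- k) \<cdot> \<one> \<oplus> (k - 1) \<cdot> \<one> = \<ominus> \<one>"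
      by (simp flip: add_scale) (simp add: scale_neg)
    finally show False by simp
  qed
qed (use assms pos_scale in simp)

lemma pos_scale_one: "\<zero> \<preceq> k \<cdot> \<one> \<longleftrightarrow> 0 \<le> k"
proof (cases "0 \<le> k")
  case False
  then have "\<zero> \<preceq> k \<cdot> \<one> \<longleftrightarrow> \<zero> \<preceq> (- k) \<cdot> (- 1) \<cdot> \<one>"
    by (simp add: scale_scale)
  also have "\<dots> \<longleftrightarrow> False"
    using False by (subst pos_scale_iff) (simp_all add: scale_neg)
  finally show ?thesis using False by simp
qed (simp add: pos_scale zero_le_one)

lemma scale_one_inj: "k \<cdot> \<one> = l \<cdot> \<one> \<longleftrightarrow> k = l"
proof
  assume "k \<cdot> \<one> = l \<cdot> \<one>"
  then have "(k - l) \<cdot> \<one> = \<zero>" "(l - k) \<cdot> \<one> = \<zero>"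
    using add_scale[of \<one> k "- l"] add_scale[of \<one> l "- k"] by (simp_all add: scale_neg)
  then show "k = l" using pos_scale_one[of "k - l"] pos_scale_one[of "l - k"] by simp
qed simp

text \<open>By discreteness, 1 can be subtracted from a nonzero \<open>a\<close> without leaving the
  nonnegative part, so \<open>a\<close> and its bound descend together. The lemma is used in two
  ways: a remainder below an integer is an integer, and a nonnegative nonstandard element exceeds
  every integer.\<close>

lemma standard_below: 
  assumes "a \<in> G" "\<zero> \<preceq> a" "a \<preceq> int n \<cdot> \<one>"
  shows "\<exists>k. a = int k \<cdot> \<one>"
  using assms
proof (induction n arbitrary: a)
  case 0
  then have "a = \<zero>" by (intro le_antisym) simp_all
  then show ?case by (intro exI[of _ 0]) simp
next
  case (Suc n)
  show ?case
  proof (cases "a = \<zero>")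
    case True
    then show ?thesis by (intro exI[of _ 0]) simp
  next
    case False
    then have "\<zero> \<preceq> a \<oplus> \<ominus> \<one>" using Suc.prems discrete le_iff one_closed by metis
    moreover have "a \<oplus> \<ominus> \<one> \<preceq> int n \<cdot> \<one>"
      using le_add[of a "int (Suc n) \<cdot> \<one>" "\<ominus> \<one>"] Suc.prems add_scale[of \<one> "int (Suc n)" "-1"]
      by (simp add: scale_neg)
    ultimately obtain k where "a \<oplus> \<ominus> \<one> = int k \<cdot> \<one>" using Suc.IH Suc.prems by blast
    then have "a = int (Suc k) \<cdot> \<one>"
      using scale_succ[of \<one> "int k"] Suc.prems
      by (metis add_comm neg_add_cancel(1) neg_closed of_nat_Suc one_closed add.commute)
    then show ?thesis by blast
  qed
qed

section \<open>Divisibility\<close>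

lemma dvd_iff: "n dvdg x \<longleftrightarrow> (\<exists>q\<in>G. x = n \<cdot> q)"
  by (simp add: gdvd_def)

lemma dvd_scale: "q \<in> G \<Longrightarrow> n dvd k \<Longrightarrow> n dvdg k \<cdot> q"
  unfolding dvd_iff by (auto simp: scale_scale[symmetric] elim!: dvdE)

lemma dvd_add: "n dvdg x \<Longrightarrow> n dvdg y \<Longrightarrow> n dvdg x \<oplus> y"
  unfolding dvd_iff by (metis add_closed scale_add)

lemma dvd_mult: "n dvdg x \<Longrightarrow> n dvdg k \<cdot> x"
  unfolding dvd_iff by (metis scale_closed scale_scale mult.commute)

lemma dvd_add_iff: assumes "n dvdg x" "y \<in> G" shows "n dvdg x \<oplus> y \<longleftrightarrow> n dvdg y"
proof
  assume *: "n dvdg x \<oplus> y"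
  have x: "x \<in> G" using assms unfolding dvd_iff by auto
  have "n dvdg (- 1) \<cdot> x \<oplus> (x \<oplus> y)" by (intro dvd_add dvd_mult assms *)
  then show "n dvdg y" using x assms by (simp add: scale_neg)
qed (simp add: dvd_add assms)

text \<open>Removing \<open>n (k div n)\<close> leaves the remainder of k. If this is
  \<open>n q\<close>, then \<open>q >= 0\<close>, and \<open>q >= 1\<close> would make it at least
  n; so \<open>q = 0\<close>.\<close>

lemma dvd_one: assumes "0 < n" shows "n dvdg k \<cdot> \<one> \<longleftrightarrow> n dvd k"
proof
  assume "n dvdg k \<cdot> \<one>"
  moreover have k: "k \<cdot> \<one> = (n * (k div n)) \<cdot> \<one> \<oplus> (k mod n) \<cdot> \<one>"
    by (simp flip: add_scale)
  ultimately have "n dvdg (k mod n) \<cdot> \<one>"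
    using dvd_add_iff dvd_scale by simp
  then obtain q where q: "q \<in> G" "(k mod n) \<cdot> \<one> = n \<cdot> q" unfolding dvd_iff by auto
  have "\<zero> \<preceq> n \<cdot> q" using assms by (simp flip: q(2) add: pos_scale_one)
  then have "\<zero> \<preceq> q" using assms q pos_scale_iff by simp
  have "q = \<zero>"
  proof (rule ccontr)
    assume "q \<noteq> \<zero>"
    then have "\<zero> \<preceq> q \<oplus> \<ominus> \<one>" using discrete[OF q(1) \<open>\<zero> \<preceq> q\<close>] le_iff[of \<one> q] q(1) by simp
    then have "\<zero> \<preceq> n \<cdot> (q \<oplus> \<ominus> \<one>)" by (rule pos_scale[rotated]) (use assms q(1) in simp_all)
    also have "n \<cdot> (q \<oplus> \<ominus> \<one>) = n \<cdot> q \<oplus> (- n) \<cdot> \<one>"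
      using q(1) by (simp add: scale_add scale_minus)
    also have "\<dots> = (k mod n + - n) \<cdot> \<one>"
      using add_scale[of \<one> "k mod n" "- n"] q(2) by simp
    finally show False using assms pos_mod_bound[OF assms, of k] by (simp add: pos_scale_one)
  qed
  then show "n dvd k" using scale_one_inj[of "k mod n" 0] q by (simp add: dvd_eq_mod_eq_0)
qed (simp add: dvd_scale)

end

text \<open>The remainder is an integer and not just a group element below n, so that residues can
  be written as numeral terms.\<close>

locale zgroup = discrete_ordered_group +
  assumes division: "a \<in> G \<Longrightarrow> 0 < n \<Longrightarrow> \<exists>q\<in>G. \<exists>r. 0 \<le> r \<and> r < n \<and> a = n \<cdot> q \<oplus> r \<cdot> \<one>"

section \<open>Quantifier elimination\<close>

definition gmul :: "int \<Rightarrow> gtm \<Rightarrow> gtm" where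
  "gmul k s = (if 0 \<le> k then (GAdd s ^^ nat k) GZero else GNeg ((GAdd s ^^ nat (- k)) GZero))"

abbreviation num :: "int \<Rightarrow> gtm" where "num k \<equiv> gmul k GOne"
abbreviation gsub :: "gtm \<Rightarrow> gtm \<Rightarrow> gtm" where "gsub s t \<equiv> GAdd s (GNeg t)"

lemma eval_iterate: "eval_gtm M e ((GAdd s ^^ n) GZero) = mult M n (eval_gtm M e s)"
  by (induction n) simp_all

lemma eval_gmul [simp]: "eval_gtm M e (gmul k s) = smul M k (eval_gtm M e s)"
  by (simp add: gmul_def smul_def eval_iterate)

lemma fv_iterate: "fv_gtm ((GAdd s ^^ n) GZero) \<subseteq> fv_gtm s"
  by (induction n) auto

lemma fv_gmul: "fv_gtm (gmul k s) \<subseteq> fv_gtm s"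
  using fv_iterate by (auto simp: gmul_def)

primrec coef :: "nat \<Rightarrow> gtm \<Rightarrow> int" where
  "coef x (GVar y) = (if x = y then 1 else 0)"
| "coef x GZero = 0"
| "coef x GOne = 0"
| "coef x (GAdd s t) = coef x s + coef x t"
| "coef x (GNeg s) = - coef x s"

primrec rest :: "nat \<Rightarrow> gtm \<Rightarrow> gtm" where
  "rest x (GVar y) = (if x = y then GZero else GVar y)"
| "rest x GZero = GZero"
| "rest x GOne = GOne"
| "rest x (GAdd s t) = GAdd (rest x s) (rest x t)"
| "rest x (GNeg s) = GNeg (rest x s)"

text \<open>An equality is a pair of comparisons, and agreement of two structures on an atom is also
  agreement on its negation, so two kinds of atoms cover all cases.\<close>

datatype atom = Pos gtm | Dvd int gtm

text \<open>A divisibility with nonpositive modulus is false by convention: all structures agree on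
  it, and \<open>modulus\<close> can count it as 1.\<close>

primrec holds :: "'a gstr \<Rightarrow> (nat \<Rightarrow> 'a) \<Rightarrow> atom \<Rightarrow> bool" where
  "holds M e (Pos s) \<longleftrightarrow> le M (zero M) (eval_gtm M e s)"
| "holds M e (Dvd n s) \<longleftrightarrow> 0 < n \<and> gdvd M n (eval_gtm M e s)"

primrec atm :: "atom \<Rightarrow> gtm" where
  "atm (Pos s) = s"
| "atm (Dvd n s) = s"

primrec modulus :: "atom \<Rightarrow> int" where
  "modulus (Pos s) = 1"
| "modulus (Dvd n s) = (if 0 < n then n else 1)"

text \<open>
  Virtual substitution of \<open>y + i\<close> for the multiple \<open>C x\<close> of \<open>x\<close>, where \<open>j\<close> is the residue
  of \<open>x\<close> modulo a common multiple of the moduli.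
\<close>
primrec vsubst :: "nat \<Rightarrow> int \<Rightarrow> gtm \<Rightarrow> int \<Rightarrow> atom \<Rightarrow> atom" where
  "vsubst x C y j (Pos s) =
     Pos (if coef x s = 0 then rest x s
          else GAdd (gmul (sgn (coef x s)) y) (gmul (C div \<bar>coef x s\<bar>) (rest x s)))"
| "vsubst x C y j (Dvd n s) = Dvd n (GAdd (num (coef x s * j)) (rest x s))"

text \<open>
  In the case of an upper bound \<open>t\<close>, one is added to turn \<open>C x \<le> t\<close> into the negation of
  \<open>t + 1 \<le> C x\<close>, so that only comparisons of one kind are left.
\<close>
definition bound :: "nat \<Rightarrow> int \<Rightarrow> gtm \<Rightarrow> gtm" where
  "bound x C s =
     (if 0 < coef x s then gmul (- (C div coef x s)) (rest x s)
      else GAdd (gmul (C div - coef x s) (rest x s)) GOne)"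

section \<open>Virtual substitution and test values\<close>

context zgroup begin

lemma cancel [simp]:
  assumes "a \<in> G" "b \<in> G"
  shows "a \<oplus> (b \<oplus> \<ominus> a) = b" "\<ominus> a \<oplus> (b \<oplus> a) = b"
    and "c \<in> G \<Longrightarrow> a \<oplus> (b \<oplus> (\<ominus> a \<oplus> c)) = b \<oplus> c"
    and "c \<in> G \<Longrightarrow> \<ominus> a \<oplus> (b \<oplus> (a \<oplus> c)) = b \<oplus> c"
  using assms by (simp_all add: add_lcomm[of _ b] add_comm[of _ b] add_comm[of "\<ominus> a" a])

lemma eval_closed [simp]: "range e \<subseteq> G \<Longrightarrow> eval_gtm M e s \<in> G"
  by (induction s) auto

lemma eval_upd:
  assumes "range e \<subseteq> G" "a \<in> G"
  shows "eval_gtm M (e(x := a)) s = coef x s \<cdot> a \<oplus> eval_gtm M e (rest x s)"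
proof -
  have "e y \<in> G" for y using assms by auto
  then show ?thesis
    by (induction s) (use assms in \<open>auto simp: neg_add scale_neg add_scale add_ac\<close>)
qed

lemma range_upd: "range e \<subseteq> G \<Longrightarrow> a \<in> G \<Longrightarrow> range (e(x := a)) \<subseteq> G"
  by auto

text \<open>Multiplied by the positive integer \<open>C / |c|\<close>, the atom
  \<open>c a + r >= 0\<close> compares \<open>C a\<close> with its bound, and by the last assumption
  \<open>y\<close> lies on the same side of that bound. A divisibility sees \<open>a\<close> only
  modulo L, hence only through j.\<close>

lemma holds_vsubst:
  assumes e: "range e \<subseteq> G" and a: "a \<in> G" and C: "0 < C" "coef x (atm \<alpha>) \<noteq> 0 \<Longrightarrow> coef x (atm \<alpha>) dvd C"
    and L: "modulus \<alpha> dvd L" "L dvdg a \<oplus> \<ominus> (j \<cdot> \<one>)"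
    and b: "eval_gtm M e (bound x C (atm \<alpha>)) \<preceq> C \<cdot> a \<longleftrightarrow>
            eval_gtm M e (bound x C (atm \<alpha>)) \<preceq> eval_gtm M e y"
  shows "holds M (e(x := a)) \<alpha> \<longleftrightarrow> holds M e (vsubst x C y j \<alpha>)"
proof (cases \<alpha>)
  case (Pos s)
  define c where "c = coef x s"
  define r where "r = eval_gtm M e (rest x s)"
  define v where "v = eval_gtm M e y"
  have [simp]: "r \<in> G" "v \<in> G" using e by (simp_all add: r_def v_def)
  have *: "holds M (e(x := a)) \<alpha> \<longleftrightarrow> \<zero> \<preceq> c \<cdot> a \<oplus> r"
    using Pos e a by (simp add: eval_upd c_def r_def)
  consider "c = 0" | "0 < c" | "c < 0" by linarith
  then show ?thesis
  proof cases
    case 1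
    then show ?thesis using * a e by (simp add: Pos c_def r_def)
  next
    case 2
    define d where "d = C div c"
    have d: "d * c = C" "0 < d" using C(2) 2 Pos C(1)
      by (auto simp: c_def d_def pos_imp_zdiv_pos_iff zdvd_imp_le)
    have "\<zero> \<preceq> c \<cdot> a \<oplus> r \<longleftrightarrow> \<zero> \<preceq> d \<cdot> (c \<cdot> a \<oplus> r)" using d a by (simp add: pos_scale_iff)
    also have "\<dots> \<longleftrightarrow> (- d) \<cdot> r \<preceq> C \<cdot> a" using a d
      by (subst le_iff[of "(- d) \<cdot> r"]) (simp_all add: scale_add scale_scale scale_neg)
    also have "\<dots> \<longleftrightarrow> (- d) \<cdot> r \<preceq> v"
      using b 2 by (simp add: Pos bound_def c_def d_def r_def v_def)
    also have "\<dots> \<longleftrightarrow> \<zero> \<preceq> v \<oplus> d \<cdot> r"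
      by (subst le_iff) (simp_all add: scale_neg)
    finally show ?thesis using 2 * by (simp add: Pos c_def d_def r_def v_def e)
  next
    case 3
    define d where "d = C div - c"
    obtain k where k: "C = c * k" using C(2) 3 Pos by (auto simp: c_def)
    have "d = - k" using 3 nonzero_mult_div_cancel_left[of "- c" "- k"] by (simp add: d_def k)
    then have d: "d * c = - C" "0 < d" using 3 C(1) by (simp_all add: k zero_less_mult_iff)
    have le: "\<not> d \<cdot> r \<oplus> \<one> \<preceq> w \<longleftrightarrow> \<zero> \<preceq> \<ominus> w \<oplus> d \<cdot> r" if "w \<in> G" for w
      using that by (subst le_iff) (simp_all add: not_pos neg_add add_assoc)
    have "\<zero> \<preceq> c \<cdot> a \<oplus> r \<longleftrightarrow> \<zero> \<preceq> d \<cdot> (c \<cdot> a \<oplus> r)" using d a by (simp add: pos_scale_iff)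
    also have "\<dots> \<longleftrightarrow> \<not> d \<cdot> r \<oplus> \<one> \<preceq> C \<cdot> a" using a d
      by (subst le) (simp_all add: scale_add scale_scale scale_neg)
    also have "\<dots> \<longleftrightarrow> \<not> d \<cdot> r \<oplus> \<one> \<preceq> v"
      using b 3 by (simp add: Pos bound_def c_def d_def r_def v_def)
    also have "\<dots> \<longleftrightarrow> \<zero> \<preceq> \<ominus> v \<oplus> d \<cdot> r"
      by (simp add: le)
    finally show ?thesis using 3 * by (simp add: Pos c_def d_def r_def v_def e scale_neg)
  qed
next
  case (Dvd n s)
  define c where "c = coef x s"
  define r where "r = eval_gtm M e (rest x s)"
  have [simp]: "r \<in> G" using e by (simp_all add: r_def)
  have "n dvdg c \<cdot> a \<oplus> r \<longleftrightarrow> n dvdg (c * j) \<cdot> \<one> \<oplus> r" if n: "0 < n"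
  proof -
    obtain m where "L = n * m" using L(1) Dvd n by (auto simp: dvd_def)
    then have "n dvdg a \<oplus> \<ominus> (j \<cdot> \<one>)"
      using L(2) unfolding dvd_iff by (metis scale_closed scale_scale)
    then have 1: "n dvdg c \<cdot> (a \<oplus> \<ominus> (j \<cdot> \<one>))" by (rule dvd_mult)
    have "c \<cdot> a \<oplus> r = c \<cdot> (a \<oplus> \<ominus> (j \<cdot> \<one>)) \<oplus> ((c * j) \<cdot> \<one> \<oplus> r)"
      using a by (simp add: scale_add scale_minus scale_scale scale_neg add_assoc)
    then show ?thesis using dvd_add_iff[OF 1] by simp
  qed
  then show ?thesis using e a by (auto simp: Dvd eval_upd c_def r_def)
qed

lemma ex_max:
  assumes "finite S" "S \<noteq> {}" "f ` S \<subseteq> G"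
  shows "\<exists>s\<in>S. \<forall>t\<in>S. f t \<preceq> f s"
  using assms
proof (induction S rule: finite_ne_induct)
  case (insert s S)
  then obtain t where t: "t \<in> S" "\<forall>u\<in>S. f u \<preceq> f t" by auto
  have "f s \<in> G" "f t \<in> G" "\<forall>u\<in>S. f u \<in> G" using insert t by auto
  then show ?case
    using t le_total[of "f s" "f t"] le_trans le_refl by (metis insert_iff)
qed simp

lemma division_residue:
  assumes "a \<in> G" "0 < n" shows "\<exists>j\<in>{0..<n}. n dvdg a \<oplus> \<ominus> (j \<cdot> \<one>)"
proof -
  obtain q r where "q \<in> G" "0 \<le> r" "r < n" "a = n \<cdot> q \<oplus> r \<cdot> \<one>" using division[OF assms] by blast
  then show ?thesis unfolding dvd_iff by (intro bexI[of _ r] bexI[of _ q]) (simp_all add: add_assoc)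
qed

text \<open>If some \<open>f s\<close> is at most \<open>v\<close>, take the greatest such and let i
  be the remainder of \<open>v - f s\<close> modulo D: the translate lies between \<open>f s\<close>
  and \<open>v\<close>, so no further element of S separates it from \<open>v\<close>. If all
  elements exceed \<open>v\<close>, start from the least one and descend.\<close>

lemma ex_translate:
  assumes S: "finite S" "S \<noteq> {}" "f ` S \<subseteq> G" and v: "v \<in> G" and D: "0 < D"
  shows "\<exists>s\<in>S. \<exists>i\<in>{-D..D}. D dvdg v \<oplus> \<ominus> (f s \<oplus> i \<cdot> \<one>) \<and>
           (\<forall>t\<in>S. f t \<preceq> v \<longleftrightarrow> f t \<preceq> f s \<oplus> i \<cdot> \<one>)"
proof (cases "\<exists>s\<in>S. f s \<preceq> v")
  case True
  define S' where "S' = {s\<in>S. f s \<preceq> v}"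
  obtain s where s: "s \<in> S'" "\<forall>t\<in>S'. f t \<preceq> f s"
    using ex_max[of S' f] True S unfolding S'_def by auto
  then have [simp]: "f s \<in> G" and sv: "f s \<preceq> v" "s \<in> S" using S by (auto simp: S'_def)
  obtain q i where q: "q \<in> G" "0 \<le> i" "i < D" "v \<oplus> \<ominus> f s = D \<cdot> q \<oplus> i \<cdot> \<one>"
    using division[OF _ D, of "v \<oplus> \<ominus> f s"] v by auto
  have "v = f s \<oplus> (v \<oplus> \<ominus> f s)" using v by (simp add: add_ac)
  then have veq: "v = D \<cdot> q \<oplus> (f s \<oplus> i \<cdot> \<one>)" using q by (simp add: add_ac)
  have "\<zero> \<preceq> q"
  proof (rule ccontr)
    assume "\<not> \<zero> \<preceq> q"
    then have 1: "\<zero> \<preceq> D \<cdot> (\<ominus> q \<oplus> \<ominus> \<one>)"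
      using not_pos q D by (intro pos_scale) simp_all
    have 2: "\<zero> \<preceq> D \<cdot> q \<oplus> i \<cdot> \<one>" using sv v le_iff[of "f s" v] q(4) by simp
    have "\<zero> \<preceq> D \<cdot> (\<ominus> q \<oplus> \<ominus> \<one>) \<oplus> (D \<cdot> q \<oplus> i \<cdot> \<one>)"
      using q(1) by (intro pos_add[OF _ _ 1 2]) simp_all
    also have "D \<cdot> (\<ominus> q \<oplus> \<ominus> \<one>) \<oplus> (D \<cdot> q \<oplus> i \<cdot> \<one>) = (i + - D) \<cdot> \<one>"
      using q(1) by (subst add_scale) (simp_all add: scale_add scale_minus scale_neg add_ac)
    finally show False using q(3) by (simp add: pos_scale_one)
  qed
  then have si: "f s \<oplus> i \<cdot> \<one> \<preceq> v"
    using veq q D pos_scale[of q D] le_iff[of "f s \<oplus> i \<cdot> \<one>" v] v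
    by (simp add: add_assoc)
  have "f s \<preceq> f s \<oplus> i \<cdot> \<one>"
    using q(2) by (subst le_iff) (simp_all add: add_comm[of "f s"] add_assoc pos_scale_one)
  then have "f t \<preceq> v \<longleftrightarrow> f t \<preceq> f s \<oplus> i \<cdot> \<one>" if "t \<in> S" for t
    using that s S si v le_trans[of "f t" "f s" "f s \<oplus> i \<cdot> \<one>"] le_trans[of "f t" "f s \<oplus> i \<cdot> \<one>" v]
    by (auto simp: S'_def)
  moreover have "D dvdg v \<oplus> \<ominus> (f s \<oplus> i \<cdot> \<one>)"
    unfolding dvd_iff using q(1) v veq by (intro bexI[of _ q]) (simp_all add: add_assoc)
  ultimately show ?thesis using sv q(2,3) by (intro bexI[of _ s] bexI[of _ i]) auto
next
  case False
  obtain s where s: "s \<in> S" "\<forall>t\<in>S. f s \<preceq> f t"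
  proof -
    have "\<exists>s\<in>S. \<forall>t\<in>S. \<ominus> f t \<preceq> \<ominus> f s" using S by (intro ex_max) auto
    moreover have "\<ominus> a \<preceq> \<ominus> b \<longleftrightarrow> b \<preceq> a" if "a \<in> G" "b \<in> G" for a b
      using that le_iff[of "\<ominus> a" "\<ominus> b"] le_iff[of b a] by (simp add: add_comm)
    ultimately show ?thesis using that S by (metis image_subset_iff)
  qed
  have [simp]: "f s \<in> G" using s S by auto
  \<comment> \<open>Dividing \<open>f s - 1 - v\<close> instead of \<open>f s - v\<close> yields the
    translate \<open>f s - 1 - i\<close>, which is strictly below \<open>f s\<close> even for i = 0;
    the offset is still at least - D.\<close>
  obtain q i where q: "q \<in> G" "0 \<le> i" "i < D" "f s \<oplus> \<ominus> \<one> \<oplus> \<ominus> v = D \<cdot> q \<oplus> i \<cdot> \<one>"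
    using division[OF _ D, of "f s \<oplus> \<ominus> \<one> \<oplus> \<ominus> v"] v by auto
  have "\<ominus> (f s \<oplus> \<ominus> \<one> \<oplus> \<ominus> v) \<oplus> (\<ominus> \<one> \<oplus> f s) = v"
    using v by (simp add: neg_add add_ac)
  then have "v = \<ominus> (D \<cdot> q \<oplus> i \<cdot> \<one>) \<oplus> (\<ominus> \<one> \<oplus> f s)" by (simp add: q(4))
  also have "\<dots> = D \<cdot> \<ominus> q \<oplus> (f s \<oplus> (\<ominus> \<one> \<oplus> \<ominus> (i \<cdot> \<one>)))"
    using q(1) by (simp add: neg_add scale_minus scale_neg add_ac)
  also have "\<ominus> \<one> \<oplus> \<ominus> (i \<cdot> \<one>) = (- 1 - i) \<cdot> \<one>"
    using add_scale[of \<one> "- 1" "- i"] by (simp add: scale_neg)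
  finally have veq: "v = D \<cdot> \<ominus> q \<oplus> (f s \<oplus> (- 1 - i) \<cdot> \<one>)" .
  have "\<not> f t \<preceq> f s \<oplus> (- 1 - i) \<cdot> \<one>" if "t \<in> S" for t
  proof
    assume "f t \<preceq> f s \<oplus> (- 1 - i) \<cdot> \<one>"
    then have "f s \<preceq> f s \<oplus> (- 1 - i) \<cdot> \<one>" using s that S le_trans[of "f s" "f t"] by auto
    then have "\<zero> \<preceq> (- 1 - i) \<cdot> \<one>"
      using le_iff[of "f s" "f s \<oplus> (- 1 - i) \<cdot> \<one>"] by (simp add: add_comm[of "f s"] add_assoc)
    then show False using q(2) by (simp add: pos_scale_one)
  qed
  moreover have "D dvdg v \<oplus> \<ominus> (f s \<oplus> (- 1 - i) \<cdot> \<one>)"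
    unfolding dvd_iff using q(1) v veq by (intro bexI[of _ "\<ominus> q"]) (simp_all add: add_assoc)
  ultimately show ?thesis using False s q(2,3) by (intro bexI[of _ s] bexI[of _ "- 1 - i"]) auto
qed

end

context zgroup begin

text \<open>Here \<open>w\<close> is the test value standing for \<open>C a\<close>. The conclusion
  no longer mentions \<open>a\<close>, so it is an atom about the parameters alone and can be
  transferred to the other group.\<close>

lemma dvd_scaled_diff:
  assumes "a \<in> G" "w \<in> G" "L dvdg a \<oplus> \<ominus> (j \<cdot> \<one>)" "C * L dvdg C \<cdot> a \<oplus> \<ominus> w"
  shows "C * L dvdg w \<oplus> \<ominus> ((C * j) \<cdot> \<one>)"
proof -
  have "C * L dvdg C \<cdot> (a \<oplus> \<ominus> (j \<cdot> \<one>))"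
    using assms(3) unfolding dvd_iff by (auto simp: scale_scale)
  moreover have "C * L dvdg (- 1) \<cdot> (C \<cdot> a \<oplus> \<ominus> w)" using assms(4) by (rule dvd_mult)
  ultimately have "C * L dvdg C \<cdot> (a \<oplus> \<ominus> (j \<cdot> \<one>)) \<oplus> (- 1) \<cdot> (C \<cdot> a \<oplus> \<ominus> w)" by (rule dvd_add)
  also have "C \<cdot> (a \<oplus> \<ominus> (j \<cdot> \<one>)) \<oplus> (- 1) \<cdot> (C \<cdot> a \<oplus> \<ominus> w) = w \<oplus> \<ominus> ((C * j) \<cdot> \<one>)"
    using assms(1,2) by (simp add: scale_add scale_minus scale_scale scale_neg neg_add add_ac)
  finally show ?thesis .
qed

text \<open>The return trip of \<open>dvd_scaled_diff\<close>. The modulus \<open>C * L\<close>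
  guarantees at once that \<open>w\<close> has a C-th part and that this part has residue j modulo
  L; it is \<open>j + L q\<close>.\<close>

lemma ex_quotient:
  assumes "w \<in> G" "C * L dvdg w \<oplus> \<ominus> ((C * j) \<cdot> \<one>)"
  shows "\<exists>b\<in>G. C \<cdot> b = w \<and> L dvdg b \<oplus> \<ominus> (j \<cdot> \<one>)"
proof -
  obtain q where q: "q \<in> G" "w \<oplus> \<ominus> ((C * j) \<cdot> \<one>) = (C * L) \<cdot> q"
    using assms(2) unfolding dvd_iff by auto
  have "w = (C * j) \<cdot> \<one> \<oplus> (w \<oplus> \<ominus> ((C * j) \<cdot> \<one>))" using assms(1) by simp
  then have "C \<cdot> (j \<cdot> \<one> \<oplus> L \<cdot> q) = w" using q by (simp add: scale_add scale_scale)
  moreover have "L dvdg j \<cdot> \<one> \<oplus> L \<cdot> q \<oplus> \<ominus> (j \<cdot> \<one>)"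
    using q(1) by (simp add: add_assoc dvd_scale)
  ultimately show ?thesis using q(1) by (intro bexI[of _ "j \<cdot> \<one> \<oplus> L \<cdot> q"]) simp_all
qed

end

section \<open>Back and forth between Z-groups\<close>

definition agree :: "atom set \<Rightarrow> 'a gstr \<Rightarrow> (nat \<Rightarrow> 'a) \<Rightarrow> 'b gstr \<Rightarrow> (nat \<Rightarrow> 'b) \<Rightarrow> bool" where
  "agree A M e N f \<longleftrightarrow> (\<forall>\<alpha>\<in>A. holds M e \<alpha> \<longleftrightarrow> holds N f \<alpha>)"

lemma agree_mono: "A \<subseteq> B \<Longrightarrow> agree B M e N f \<Longrightarrow> agree A M e N f"
  by (auto simp: agree_def)

lemma agree_sym: "agree A M e N f \<longleftrightarrow> agree A N f M e"
  by (auto simp: agree_def)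

text \<open>The set B anticipates every choice of test value \<open>s + i\<close> and residue j: it
  holds all substituted atoms together with the conditions for a C-th part to exist. Whatever choice
  fits \<open>a\<close> in M can then be replayed in N.\<close>

lemma agree_forth:
  fixes M :: "'a gstr" and N :: "'b gstr"
  assumes M: "zgroup M" and N: "zgroup N" and A: "finite A"
  shows "\<exists>B. finite B \<and> (\<forall>e f. range e \<subseteq> carrier M \<longrightarrow> range f \<subseteq> carrier N \<longrightarrow> agree B M e N f \<longrightarrow>
           (\<forall>a\<in>carrier M. \<exists>b\<in>carrier N. agree A M (e(x := a)) N (f(x := b))))"
proof -
  interpret M: zgroup M by fact
  interpret N: zgroup N by fact
  define C where "C = (\<Prod>\<alpha>\<in>A. if coef x (atm \<alpha>) = 0 then 1 else \<bar>coef x (atm \<alpha>)\<bar>)"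
  define L where "L = (\<Prod>\<alpha>\<in>A. modulus \<alpha>)"
  define D where "D = C * L"
  \<comment> \<open>The term \<open>GZero\<close> keeps S nonempty, as \<open>ex_translate\<close>
    requires, even when A is empty.\<close>
  define S where "S = insert GZero ((\<lambda>\<alpha>. bound x C (atm \<alpha>)) ` A)"
  define I where "I = {- D..D}"
  define J where "J = {0..<L}"
  define y where "y = (\<lambda>s i. GAdd s (num i))"
  define B where "B = (\<lambda>(s, i, j, \<alpha>). vsubst x C (y s i) j \<alpha>) ` (S \<times> I \<times> J \<times> A) \<union>
    (\<lambda>(s, i, j). Dvd D (gsub (y s i) (num (C * j)))) ` (S \<times> I \<times> J)"
  have "modulus \<alpha> > 0" for \<alpha> by (cases \<alpha>) auto
  then have pos: "0 < C" "0 < L" "0 < D"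
    unfolding C_def L_def D_def by (auto intro!: prod_pos mult_pos_pos)
  have C: "coef x (atm \<alpha>) dvd C" if "\<alpha> \<in> A" "coef x (atm \<alpha>) \<noteq> 0" for \<alpha>
    using dvd_prodI[OF A that(1), of "\<lambda>\<alpha>. if coef x (atm \<alpha>) = 0 then 1 else \<bar>coef x (atm \<alpha>)\<bar>"] that
    by (simp add: C_def)
  have L: "modulus \<alpha> dvd L" if "\<alpha> \<in> A" for \<alpha>
    using dvd_prodI[OF A that] by (simp add: L_def)
  have "finite B" using A by (simp add: B_def S_def I_def J_def)
  moreover have "\<exists>b\<in>carrier N. agree A M (e(x := a)) N (f(x := b))"
    if e: "range e \<subseteq> carrier M" and f: "range f \<subseteq> carrier N" and agr: "agree B M e N f"
      and a: "a \<in> carrier M" for e f a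
  proof -
    obtain j where j: "j \<in> J" "gdvd M L (add M a (neg M (smul M j (one M))))"
      using M.division_residue[OF a pos(2)] unfolding J_def by blast
    have "\<exists>s\<in>S. \<exists>i\<in>{-D..D}. gdvd M D (add M (smul M C a) (neg M (add M (eval_gtm M e s) (smul M i (one M))))) \<and>
        (\<forall>t\<in>S. le M (eval_gtm M e t) (smul M C a) \<longleftrightarrow> le M (eval_gtm M e t) (add M (eval_gtm M e s) (smul M i (one M))))"
      using A a e pos(3) by (intro M.ex_translate) (auto simp: S_def)
    then obtain s i where si: "s \<in> S" "i \<in> I" 
      and dv: "gdvd M D (add M (smul M C a) (neg M (eval_gtm M e (y s i))))"
      and le: "\<And>t. t \<in> S \<Longrightarrow> le M (eval_gtm M e t) (smul M C a) \<longleftrightarrow> le M (eval_gtm M e t) (eval_gtm M e (y s i))"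
      by (auto simp: y_def I_def)
    have "holds M e (Dvd D (gsub (y s i) (num (C * j))))"
      using M.dvd_scaled_diff[of a "eval_gtm M e (y s i)" L j C] a e j(2) dv pos(3)
      by (simp add: D_def)
    moreover have "Dvd D (gsub (y s i) (num (C * j))) \<in> B" using si j(1) unfolding B_def by force
    ultimately have "holds N f (Dvd D (gsub (y s i) (num (C * j))))"
      using agr unfolding agree_def by blast
    \<comment> \<open>The transferred divisibility makes the test value in N an exact multiple
      \<open>C b\<close>.\<close>
    then obtain b where b: "b \<in> carrier N" "smul N C b = eval_gtm N f (y s i)"
        "gdvd N L (add N b (neg N (smul N j (one N))))"
      using N.ex_quotient[of "eval_gtm N f (y s i)" C L j] f by (auto simp: D_def)
    have "holds M (e(x := a)) \<alpha> \<longleftrightarrow> holds N (f(x := b)) \<alpha>" if \<alpha>: "\<alpha> \<in> A" for \<alpha>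
    proof -
      have "bound x C (atm \<alpha>) \<in> S" using \<alpha> by (simp add: S_def)
      from le[OF this] have "holds M (e(x := a)) \<alpha> \<longleftrightarrow> holds M e (vsubst x C (y s i) j \<alpha>)"
        using e a pos C L j \<alpha> by (intro M.holds_vsubst) auto
      also have "\<dots> \<longleftrightarrow> holds N f (vsubst x C (y s i) j \<alpha>)"
      proof -
        have "vsubst x C (y s i) j \<alpha> \<in> B" using si j(1) \<alpha> unfolding B_def by force
        then show ?thesis using agr by (simp add: agree_def)
      qed
      \<comment> \<open>In N the test value equals \<open>C b\<close>, so the comparison assumption
        of \<open>holds_vsubst\<close> is trivial.\<close>
      also have "\<dots> \<longleftrightarrow> holds N (f(x := b)) \<alpha>"
        using f b pos C L \<alpha> by (intro N.holds_vsubst[symmetric]) auto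
      finally show ?thesis .
    qed
    then show ?thesis using b(1) by (auto simp: agree_def)
  qed
  ultimately show ?thesis by (intro exI[of _ B]) auto
qed

text \<open>The finite index set of R plays the part of the number of remaining rounds in a game:
  each quantifier trades it for another finite set. R stays abstract so that one induction serves
  both groups and truncations.\<close>

lemma sat_fm_back_and_forth:
  fixes R :: "'k set \<Rightarrow> (nat \<Rightarrow> 'a) \<Rightarrow> (nat \<Rightarrow> 'b) \<Rightarrow> bool"
  assumes mono: "\<And>A B e f. A \<subseteq> B \<Longrightarrow> R B e f \<Longrightarrow> R A e f"
    and eq: "\<And>s t. \<exists>A. finite A \<and> (\<forall>e f. R A e f \<longrightarrow> (ev e s = ev e t \<longleftrightarrow> ev' f s = ev' f t))"
    and le: "\<And>s t. \<exists>A. finite A \<and> (\<forall>e f. R A e f \<longrightarrow> (le1 (ev e s) (ev e t) \<longleftrightarrow> le2 (ev' f s) (ev' f t)))"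
    and fwd: "\<And>A x. finite A \<Longrightarrow> \<exists>B. finite B \<and>
          (\<forall>e f. R B e f \<longrightarrow> (\<forall>a\<in>U. \<exists>b\<in>V. R A (e(x := a)) (f(x := b))))"
    and bck: "\<And>A x. finite A \<Longrightarrow> \<exists>B. finite B \<and>
          (\<forall>e f. R B e f \<longrightarrow> (\<forall>b\<in>V. \<exists>a\<in>U. R A (e(x := a)) (f(x := b))))"
  shows "\<exists>A. finite A \<and> (\<forall>e f. R A e f \<longrightarrow> (sat_fm U le1 ev e \<phi> \<longleftrightarrow> sat_fm V le2 ev' f \<phi>))"
proof (induction \<phi>)
  case (Eq s t)
  then show ?case using eq by simp
next
  case (Le s t)
  then show ?case using le by simp
next
  case (Neg \<phi>)
  then show ?case by simp
next
  case (Conj \<phi> \<psi>)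
  then obtain A B where AB: "finite A" "\<forall>e f. R A e f \<longrightarrow> sat_fm U le1 ev e \<phi> = sat_fm V le2 ev' f \<phi>"
    "finite B" "\<forall>e f. R B e f \<longrightarrow> sat_fm U le1 ev e \<psi> = sat_fm V le2 ev' f \<psi>" by auto
  have "sat_fm U le1 ev e (Conj \<phi> \<psi>) \<longleftrightarrow> sat_fm V le2 ev' f (Conj \<phi> \<psi>)" if "R (A \<union> B) e f" for e f
  proof -
    have "R A e f" "R B e f" using mono[OF _ that] by auto
    then show ?thesis using AB by simp
  qed
  then show ?case using AB by (intro exI[of _ "A \<union> B"]) simp
next
  case (Ex x \<phi>)
  then obtain A where A: "finite A" "\<And>e f. R A e f \<Longrightarrow> sat_fm U le1 ev e \<phi> \<longleftrightarrow> sat_fm V le2 ev' f \<phi>"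
    by blast
  from fwd[OF A(1), of x] obtain B1 where B1: "finite B1 \<and>
      (\<forall>e f. R B1 e f \<longrightarrow> (\<forall>a\<in>U. \<exists>b\<in>V. R A (e(x := a)) (f(x := b))))" ..
  from bck[OF A(1), of x] obtain B2 where B2: "finite B2 \<and>
      (\<forall>e f. R B2 e f \<longrightarrow> (\<forall>b\<in>V. \<exists>a\<in>U. R A (e(x := a)) (f(x := b))))" ..
  have "sat_fm U le1 ev e (Ex x \<phi>) \<longleftrightarrow> sat_fm V le2 ev' f (Ex x \<phi>)" if "R (B1 \<union> B2) e f" for e f
  proof -
    have "R B1 e f" "R B2 e f" using mono[OF _ that] by auto
    then show ?thesis using B1 B2 A(2) unfolding sat_fm.simps by meson
  qed
  then show ?case using B1 B2 by (intro exI[of _ "B1 \<union> B2"]) simp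
qed

lemma (in zgroup) holds_sub:
  assumes "range e \<subseteq> G"
  shows "holds M e (Pos (gsub t s)) \<longleftrightarrow> eval_gtm M e s \<preceq> eval_gtm M e t"
  using assms by (subst le_iff) auto

lemma (in zgroup) eq_iff_le: "a \<in> G \<Longrightarrow> b \<in> G \<Longrightarrow> a = b \<longleftrightarrow> a \<preceq> b \<and> b \<preceq> a"
  using le_antisym by auto

text \<open>That A is chosen before e and f matters in \<open>type_realized\<close>, where the same
  A is used along a whole sequence of assignments.\<close>

lemma gsat_agree:
  assumes M: "zgroup M" and N: "zgroup N"
  shows "\<exists>A. finite A \<and> (\<forall>e f. range e \<subseteq> carrier M \<longrightarrow> range f \<subseteq> carrier N \<longrightarrow>
           agree A M e N f \<longrightarrow> (gsat M e \<phi> \<longleftrightarrow> gsat N f \<phi>))"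
proof -
  interpret M: zgroup M by fact
  interpret N: zgroup N by fact
  define R where "R = (\<lambda>A e f. range e \<subseteq> carrier M \<and> range f \<subseteq> carrier N \<and> agree A M e N f)"
  have *: "le M (eval_gtm M e s) (eval_gtm M e t) \<longleftrightarrow> le N (eval_gtm N f s) (eval_gtm N f t)"
    if "R A e f" "Pos (gsub t s) \<in> A" for A e f s t
    using that M.holds_sub[of e t s] N.holds_sub[of f t s] by (auto simp: R_def agree_def)
  have "\<exists>A. finite A \<and> (\<forall>e f. R A e f \<longrightarrow> (gsat M e \<phi> \<longleftrightarrow> gsat N f \<phi>))"
    unfolding gsat_def
  proof (rule sat_fm_back_and_forth)
    fix s t
    have "eval_gtm M e s = eval_gtm M e t \<longleftrightarrow> eval_gtm N f s = eval_gtm N f t"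
      if "R {Pos (gsub t s), Pos (gsub s t)} e f" for e f
      using *[OF that, of t s] *[OF that, of s t] that M.eq_iff_le N.eq_iff_le by (simp add: R_def)
    then show "\<exists>A. finite A \<and> (\<forall>e f. R A e f \<longrightarrow>
        (eval_gtm M e s = eval_gtm M e t \<longleftrightarrow> eval_gtm N f s = eval_gtm N f t))"
      by (meson finite.intros)
    show "\<exists>A. finite A \<and> (\<forall>e f. R A e f \<longrightarrow>
        (le M (eval_gtm M e s) (eval_gtm M e t) \<longleftrightarrow> le N (eval_gtm N f s) (eval_gtm N f t)))"
      by (intro exI[of _ "{Pos (gsub t s)}"]) (auto intro!: *)
  next
    fix A x assume A: "finite (A :: atom set)"
    show "\<exists>B. finite B \<and> (\<forall>e f. R B e f \<longrightarrow>
        (\<forall>a\<in>carrier M. \<exists>b\<in>carrier N. R A (e(x := a)) (f(x := b))))"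
      using agree_forth[OF M N A, of x] M.range_upd N.range_upd unfolding R_def by meson
    show "\<exists>B. finite B \<and> (\<forall>e f. R B e f \<longrightarrow>
        (\<forall>b\<in>carrier N. \<exists>a\<in>carrier M. R A (e(x := a)) (f(x := b))))"
      using agree_forth[OF N M A, of x] M.range_upd N.range_upd unfolding R_def agree_sym[of _ M] by meson
  qed (auto simp: R_def intro: agree_mono)
  then show ?thesis by (auto simp: R_def)
qed

section \<open>Models of Presburger arithmetic\<close>

lemma sat_fm_cong:
  assumes "\<And>s e f. (\<And>x. x \<in> fv s \<Longrightarrow> e x = f x) \<Longrightarrow> ev e s = ev f s"
    and "\<And>x. x \<in> fv_fm fv \<phi> \<Longrightarrow> e x = f x"
  shows "sat_fm A le1 ev e \<phi> \<longleftrightarrow> sat_fm A le1 ev f \<phi>"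
  using assms(2)
proof (induction \<phi> arbitrary: e f)
  case (Eq s t)
  then show ?case using assms(1)[of s e f] assms(1)[of t e f] by simp
next
  case (Le s t)
  then show ?case using assms(1)[of s e f] assms(1)[of t e f] by simp
next
  case (Neg \<phi>)
  have "sat_fm A le1 ev e \<phi> \<longleftrightarrow> sat_fm A le1 ev f \<phi>"
    by (rule Neg.IH) (simp add: Neg.prems)
  then show ?case by simp
next
  case (Conj \<phi> \<psi>)
  have "sat_fm A le1 ev e \<phi> \<longleftrightarrow> sat_fm A le1 ev f \<phi>" "sat_fm A le1 ev e \<psi> \<longleftrightarrow> sat_fm A le1 ev f \<psi>"
    by (rule Conj.IH, simp add: Conj.prems)+
  then show ?case by simp
next
  case (Ex x \<phi>)
  have "sat_fm A le1 ev (e(x := a)) \<phi> \<longleftrightarrow> sat_fm A le1 ev (f(x := a)) \<phi>" for a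
    by (rule Ex.IH) (simp add: Ex.prems)
  then show ?case by simp
qed

lemma eval_gtm_cong: "(\<And>x. x \<in> fv_gtm s \<Longrightarrow> e x = f x) \<Longrightarrow> eval_gtm M e s = eval_gtm M f s"
  by (induction s) auto

lemma eval_ttm_cong: "(\<And>x. x \<in> fv_ttm s \<Longrightarrow> e x = f x) \<Longrightarrow> eval_ttm M e s = eval_ttm M f s"
  by (induction s) auto

lemma gsat_cong: "(\<And>x. x \<in> fv_fm fv_gtm \<phi> \<Longrightarrow> e x = f x) \<Longrightarrow> gsat M e \<phi> \<longleftrightarrow> gsat M f \<phi>"
  unfolding gsat_def by (rule sat_fm_cong[OF eval_gtm_cong])

lemma tsat_cong: "(\<And>x. x \<in> fv_fm fv_ttm \<phi> \<Longrightarrow> e x = f x) \<Longrightarrow> tsat M e \<phi> \<longleftrightarrow> tsat M f \<phi>"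
  unfolding tsat_def by (rule sat_fm_cong[OF eval_ttm_cong])

lemma gtrue_sentence:
  "fv_fm fv_gtm \<phi> = {} \<Longrightarrow> range e \<subseteq> carrier M \<Longrightarrow> gtrue M \<phi> \<longleftrightarrow> gsat M e \<phi>"
  using gsat_cong[of \<phi> _ e M] by (auto simp: gtrue_def)

lemma ttrue_sentence:
  "fv_fm fv_ttm \<phi> = {} \<Longrightarrow> range e \<subseteq> carrier M \<Longrightarrow> ttrue M \<phi> \<longleftrightarrow> tsat M e \<phi>"
  using tsat_cong[of \<phi> _ e M] by (auto simp: ttrue_def)

text \<open>Serves both the isomorphisms of truncations and the relabelling
  \<open>encode\<close>.\<close>

lemma sat_fm_iso:
  assumes h: "bij_betw h A B"
    and le: "\<And>a b. a \<in> A \<Longrightarrow> b \<in> A \<Longrightarrow> le1 a b \<longleftrightarrow> le2 (h a) (h b)"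
    and ev: "\<And>e s. range e \<subseteq> A \<Longrightarrow> ev e s \<in> A \<and> ev' (\<lambda>x. h (e x)) s = h (ev e s)"
    and e: "range e \<subseteq> A"
  shows "sat_fm A le1 ev e \<phi> \<longleftrightarrow> sat_fm B le2 ev' (\<lambda>x. h (e x)) \<phi>"
  using e
proof (induction \<phi> arbitrary: e)
  case (Eq s t)
  then show ?case using ev bij_betw_imp_inj_on[OF h] by (simp add: inj_on_eq_iff)
next
  case (Le s t)
  then show ?case using ev le by simp
next
  case (Ex x \<phi>)
  have "(\<lambda>x. h (e x))(x := h a) = (\<lambda>y. h ((e(x := a)) y))" for a by auto
  moreover have "range (e(x := a)) \<subseteq> A" if "a \<in> A" for a using Ex.prems that by auto
  moreover have "B = h ` A" using h by (simp add: bij_betw_def)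
  ultimately show ?case using Ex.IH by (simp del: fun_upd_apply)
qed auto

lemma iso_elem_equiv:
  assumes S: "is_tstr S" and h: "tstr_iso h S T"
  shows "elem_equiv S T"
  unfolding elem_equiv_def
proof (intro allI impI)
  fix \<phi> :: "ttm fm" assume \<phi>: "fv_fm fv_ttm \<phi> = {}"
  let ?e = "\<lambda>_. zero S"
  have e: "range ?e \<subseteq> carrier S" using S by (auto simp: is_tstr_def)
  have bij: "bij_betw h (carrier S) (carrier T)" using h by (simp add: tstr_iso_def)
  have he: "range (\<lambda>_. h (zero S)) \<subseteq> carrier T" using e bij by (auto simp: bij_betw_def)
  have "eval_ttm S e s \<in> carrier S \<and> eval_ttm T (\<lambda>x. h (e x)) s = h (eval_ttm S e s)"
    if "range e \<subseteq> carrier S" for e s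
    by (induction s) (use that S h in \<open>auto simp: is_tstr_def tstr_iso_def\<close>)
  then have "tsat S ?e \<phi> \<longleftrightarrow> tsat T (\<lambda>_. h (zero S)) \<phi>"
    unfolding tsat_def using h e by (intro sat_fm_iso[OF bij]) (auto simp: tstr_iso_def)
  then show "ttrue S \<phi> \<longleftrightarrow> ttrue T \<phi>"
    by (simp only: ttrue_sentence[OF \<phi> e] ttrue_sentence[OF \<phi> he])
qed

section \<open>The models of Presburger arithmetic are the Z-groups\<close>

lemma smul_int [simp]: "smul int_gstr k x = k * x"
proof -
  have "mult int_gstr n x = int n * x" for n x
    by (induction n) (simp_all add: int_gstr_def algebra_simps)
  then show ?thesis by (simp add: smul_def) (simp add: int_gstr_def)
qed

lemma gdvd_int [simp]: "gdvd int_gstr n x \<longleftrightarrow> n dvd x"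
  by (simp add: gdvd_def dvd_def int_gstr_def[THEN arg_cong[where f = carrier]])

lemma int_gstr_sel [simp]:
  "carrier int_gstr = UNIV" "zero int_gstr = 0" "one int_gstr = 1"
  "add int_gstr = (+)" "neg int_gstr = uminus" "le int_gstr = (\<le>)"
  by (simp_all add: int_gstr_def)

lemma zgroup_int: "zgroup int_gstr"
proof
  fix a n :: int assume "0 < n"
  then show "\<exists>q\<in>carrier int_gstr. \<exists>r\<ge>0. r < n \<and>
      a = add int_gstr (smul int_gstr n q) (smul int_gstr r (one int_gstr))"
    by simp (rule exI[of _ "a div n"], rule exI[of _ "a mod n"], simp)
qed auto

lemma (in zgroup) eval_numerals:
  "eval_gtm M (\<lambda>x. z x \<cdot> \<one>) s = eval_gtm int_gstr z s \<cdot> \<one>"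
  by (induction s) (simp_all add: add_scale scale_neg)

text \<open>The multiples of 1 form a copy of the integers whose order and divisibilities are the
  same computed inside as in the whole group.\<close>

lemma (in zgroup) holds_numerals:
  "holds M (\<lambda>x. z x \<cdot> \<one>) \<alpha> \<longleftrightarrow> holds int_gstr z \<alpha>"
  by (cases \<alpha>) (auto simp: eval_numerals pos_scale_one dvd_one)

lemma zgroup_imp_model:
  assumes "zgroup M" shows "presburger_model M"
proof -
  interpret zgroup M by fact
  have "gtrue M \<phi>" if \<phi>: "fv_fm fv_gtm \<phi> = {}" "gtrue int_gstr \<phi>" for \<phi>
  proof -
    obtain A where A: "\<forall>e f. range e \<subseteq> G \<longrightarrow> range f \<subseteq> carrier int_gstr \<longrightarrow>
        agree A M e int_gstr f \<longrightarrow> (gsat M e \<phi> \<longleftrightarrow> gsat int_gstr f \<phi>)"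
      using gsat_agree[OF assms zgroup_int] by blast
    \<comment> \<open>Zero is written as \<open>0\<close> times 1 to make it an instance of
      \<open>holds_numerals\<close>. For a sentence this single assignment suffices.\<close>
    have "agree A M (\<lambda>x. 0 \<cdot> \<one>) int_gstr (\<lambda>x. 0)"
      unfolding agree_def using holds_numerals[of "\<lambda>_. 0"] by simp
    then have "gsat M (\<lambda>x. 0 \<cdot> \<one>) \<phi>"
      using A that(2) by (auto simp: gtrue_def)
    then show ?thesis using gtrue_sentence[OF \<phi>(1), of "\<lambda>x. 0 \<cdot> \<one>" M] by auto
  qed
  then show ?thesis unfolding presburger_model_def is_gstr_def presburger_def by auto
qed

abbreviation Forall :: "nat \<Rightarrow> 't fm \<Rightarrow> 't fm" where "Forall x \<phi> \<equiv> Neg (Ex x (Neg \<phi>))"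
abbreviation Implies :: "'t fm \<Rightarrow> 't fm \<Rightarrow> 't fm" where "Implies \<phi> \<psi> \<equiv> Neg (Conj \<phi> (Neg \<psi>))"

text \<open>Each axiom is a sentence true in the integers, except division: there is one such
  sentence for each n, and its remainder is quantified over the group.\<close>

lemma model_imp_zgroup:
  assumes M: "presburger_model M" shows "zgroup M"
proof -
  define e where "e = (\<lambda>_::nat. zero M)"
  have e: "range e \<subseteq> carrier M" using M by (auto simp: e_def presburger_model_def is_gstr_def)
  have ax: "gsat M e \<phi>" if "fv_fm fv_gtm \<phi> = {}" "\<And>f. gsat int_gstr f \<phi>" for \<phi>
    using M that e by (auto simp: presburger_model_def presburger_def gtrue_def)
  note sat = gsat_def
  have closed: "zero M \<in> carrier M" "one M \<in> carrier M"
      "\<And>a b. a \<in> carrier M \<Longrightarrow> b \<in> carrier M \<Longrightarrow> add M a b \<in> carrier M"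
      "\<And>a. a \<in> carrier M \<Longrightarrow> neg M a \<in> carrier M"
    using M by (auto simp: presburger_model_def is_gstr_def)
  have 1: "add M (add M a b) c = add M a (add M b c)"
    if "a \<in> carrier M" "b \<in> carrier M" "c \<in> carrier M" for a b c
    using ax[of "Forall 0 (Forall 1 (Forall 2 (Eq (GAdd (GAdd (GVar 0) (GVar 1)) (GVar 2)) (GAdd (GVar 0) (GAdd (GVar 1) (GVar 2))))))"] that
    by (auto simp: sat)
  have 2: "add M a b = add M b a" if "a \<in> carrier M" "b \<in> carrier M" for a b
    using ax[of "Forall 0 (Forall 1 (Eq (GAdd (GVar 0) (GVar 1)) (GAdd (GVar 1) (GVar 0))))"] that
    by (auto simp: sat)
  have 3: "add M a (zero M) = a" if "a \<in> carrier M" for a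
    using ax[of "Forall 0 (Eq (GAdd (GVar 0) GZero) (GVar 0))"] that by (auto simp: sat)
  have 4: "add M a (neg M a) = zero M" if "a \<in> carrier M" for a
    using ax[of "Forall 0 (Eq (GAdd (GVar 0) (GNeg (GVar 0))) GZero)"] that by (auto simp: sat)
  have 5: "le M a b \<or> le M b a" if "a \<in> carrier M" "b \<in> carrier M" for a b
  proof -
    have "gsat M e (Forall 0 (Forall 1 (Implies (Neg (Le (GVar 0) (GVar 1))) (Le (GVar 1) (GVar 0)))))"
      by (rule ax) (auto simp: sat)
    then show ?thesis using that by (auto simp: sat)
  qed
  have 6: "a = b" if "a \<in> carrier M" "b \<in> carrier M" "le M a b" "le M b a" for a b
    using ax[of "Forall 0 (Forall 1 (Implies (Le (GVar 0) (GVar 1)) (Implies (Le (GVar 1) (GVar 0)) (Eq (GVar 0) (GVar 1)))))"] that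
    by (auto simp: sat)
  have 7: "le M a c" if "a \<in> carrier M" "b \<in> carrier M" "c \<in> carrier M" "le M a b" "le M b c" for a b c
    using ax[of "Forall 0 (Forall 1 (Forall 2 (Implies (Le (GVar 0) (GVar 1)) (Implies (Le (GVar 1) (GVar 2)) (Le (GVar 0) (GVar 2))))))"] that
    by (auto simp: sat)
  have 8: "le M (add M a c) (add M b c)"
    if "a \<in> carrier M" "b \<in> carrier M" "c \<in> carrier M" "le M a b" for a b c
    using ax[of "Forall 0 (Forall 1 (Forall 2 (Implies (Le (GVar 0) (GVar 1)) (Le (GAdd (GVar 0) (GVar 2)) (GAdd (GVar 1) (GVar 2))))))"] that
    by (auto simp: sat)
  have 9: "le M (zero M) (one M)" using ax[of "Le GZero GOne"] by (auto simp: sat)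
  have 10: "zero M \<noteq> one M" using ax[of "Neg (Eq GZero GOne)"] by (auto simp: sat)
  have 11: "le M (one M) a" if "a \<in> carrier M" "le M (zero M) a" "a \<noteq> zero M" for a
  proof -
    have "gsat M e (Forall 0 (Implies (Le GZero (GVar 0)) (Implies (Neg (Eq (GVar 0) GZero)) (Le GOne (GVar 0)))))"
      by (rule ax) (auto simp: sat)
    then show ?thesis using that by (auto simp: sat)
  qed
  interpret discrete_ordered_group M
    by unfold_locales (fact closed 1 2 3 4 5 6 7 8 9 10 11)+
  show ?thesis
  proof unfold_locales
    fix a and n :: int assume a: "a \<in> G" and n: "0 < n"
    let ?\<phi> = "Conj (Le GZero (GVar 2)) (Conj (Le (GAdd (GVar 2) GOne) (num n))
      (Eq (GVar 0) (GAdd (gmul n (GVar 1)) (GVar 2))))"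
    have "\<exists>q r. 0 \<le> r \<and> r + 1 \<le> n \<and> x = n * q + r" for x
      by (rule exI[of _ "x div n"], rule exI[of _ "x mod n"]) (simp add: n add1_zle_eq)
    then have "gsat M e (Forall 0 (Ex 1 (Ex 2 ?\<phi>)))"
      using fv_gmul[of n GOne] fv_gmul[of n "GVar 1"] by (intro ax) (auto simp: sat)
    then obtain q r where qr: "q \<in> G" "r \<in> G" "\<zero> \<preceq> r" "r \<oplus> \<one> \<preceq> n \<cdot> \<one>" "a = n \<cdot> q \<oplus> r"
      using a by (auto simp: sat)
    \<comment> \<open>Up to here \<open>r\<close> is an arbitrary element. Since it is below n it is
      an integer, and \<open>r + 1 <= n\<close> then gives the strict bound.\<close>
    have "r \<preceq> r \<oplus> \<one>" using qr(2) zero_le_one le_iff[of r "r \<oplus> \<one>"] by (simp add: add_comm[of r] add_assoc)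
    then have "r \<preceq> int (nat n) \<cdot> \<one>" using qr n le_trans[of r "r \<oplus> \<one>" "n \<cdot> \<one>"] by simp
    then obtain k where k: "r = int k \<cdot> \<one>" using standard_below qr by blast
    have "n \<cdot> \<one> \<oplus> \<ominus> (r \<oplus> \<one>) = (n - int k - 1) \<cdot> \<one>"
      using add_scale[of \<one> "n - int k" "- 1"] add_scale[of \<one> n "- int k"]
      by (simp add: k neg_add scale_neg add_assoc)
    then have "int k < n" using qr(2,4) le_iff[of "r \<oplus> \<one>" "n \<cdot> \<one>"] by (simp add: pos_scale_one)
    then show "\<exists>q\<in>G. \<exists>r. 0 \<le> r \<and> r < n \<and> a = n \<cdot> q \<oplus> r \<cdot> \<one>"
      using qr k by (intro bexI[of _ q] exI[of _ "int k"]) auto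
  qed
qed

section \<open>Truncations\<close>

text \<open>
  The top element occupies variable \<open>0\<close> of the group terms; the variables of the truncation
  are shifted by one.
\<close>
abbreviation with_top :: "'a \<Rightarrow> (nat \<Rightarrow> 'a) \<Rightarrow> nat \<Rightarrow> 'a" where
  "with_top t e \<equiv> case_nat t e"

primrec candidates :: "ttm \<Rightarrow> gtm set" where
  "candidates (TVar x) = {GVar (Suc x)}"
| "candidates TZero = {GZero}"
| "candidates TOne = {GOne}"
| "candidates TTau = {GVar 0}"
| "candidates (TAdd s t) = insert (GVar 0) ((\<lambda>(l, l'). GAdd l l') ` (candidates s \<times> candidates t))"

primrec tests :: "ttm \<Rightarrow> atom set" where
  "tests (TVar x) = {}"
| "tests TZero = {}"
| "tests TOne = {}"
| "tests TTau = {}"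
| "tests (TAdd s t) = tests s \<union> tests t \<union>
     (\<lambda>(l, l'). Pos (gsub (GVar 0) (GAdd l l'))) ` (candidates s \<times> candidates t)"

lemma finite_candidates: "finite (candidates s)"
  by (induction s) simp_all

lemma finite_tests: "finite (tests s)"
  by (induction s) (simp_all add: finite_candidates)

section \<open>Back and forth between truncations\<close>

context
  fixes M :: "'a gstr" and t :: 'a and N :: "'b gstr" and u :: 'b
  assumes M: "zgroup M" and N: "zgroup N" and t: "t \<in> carrier M" and u: "u \<in> carrier N"
begin

interpretation M: zgroup M by (fact M)
interpretation N: zgroup N by (fact N)

definition tagree :: "atom set \<Rightarrow> (nat \<Rightarrow> 'a) \<Rightarrow> (nat \<Rightarrow> 'b) \<Rightarrow> bool" where
  "tagree A e f \<longleftrightarrow>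
     range e \<subseteq> carrier (truncation M t) \<and> range f \<subseteq> carrier (truncation N u) \<and>
     agree A M (with_top t e) N (with_top u f)"

lemma range_with_top:
  assumes "tagree A e f"
  shows "range (with_top t e) \<subseteq> carrier M" "range (with_top u f) \<subseteq> carrier N"
proof -
  have "e x \<in> carrier M" "f x \<in> carrier N" for x
    using assms by (auto simp: tagree_def truncation_def)
  then show "range (with_top t e) \<subseteq> carrier M" "range (with_top u f) \<subseteq> carrier N"
    using t u by (auto split: nat.splits)
qed

lemma tagree_le:
  assumes "tagree A e f" "Pos (gsub l' l) \<in> A"
  shows "le M (eval_gtm M (with_top t e) l) (eval_gtm M (with_top t e) l') \<longleftrightarrow>
         le N (eval_gtm N (with_top u f) l) (eval_gtm N (with_top u f) l')"
proof -
  have "holds M (with_top t e) (Pos (gsub l' l)) \<longleftrightarrow> holds N (with_top u f) (Pos (gsub l' l))"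
    using assms unfolding tagree_def agree_def by blast
  then show ?thesis
    by (simp only: M.holds_sub[OF range_with_top(1)[OF assms(1)]] N.holds_sub[OF range_with_top(2)[OF assms(1)]])
qed

lemma tagree_eq:
  assumes "tagree A e f" "Pos (gsub l' l) \<in> A" "Pos (gsub l l') \<in> A"
  shows "eval_gtm M (with_top t e) l = eval_gtm M (with_top t e) l' \<longleftrightarrow>
         eval_gtm N (with_top u f) l = eval_gtm N (with_top u f) l'"
  using tagree_le[OF assms(1,2)] tagree_le[OF assms(1,3)] range_with_top[OF assms(1)]
    M.eq_iff_le N.eq_iff_le M.eval_closed N.eval_closed by metis

text \<open>One linear term \<open>l\<close> serves on both sides: agreement on the tests makes both
  structures cut off sums at the same places.\<close>

lemma eval_truncation:
  assumes "tagree A e f" "tests s \<subseteq> A"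
  shows "\<exists>l\<in>candidates s. eval_ttm (truncation M t) e s = eval_gtm M (with_top t e) l \<and>
           eval_ttm (truncation N u) f s = eval_gtm N (with_top u f) l"
  using assms(2)
proof (induction s)
  case (TAdd s s')
  then obtain l l' where l: "l \<in> candidates s" "l' \<in> candidates s'"
    "eval_ttm (truncation M t) e s = eval_gtm M (with_top t e) l"
    "eval_ttm (truncation N u) f s = eval_gtm N (with_top u f) l"
    "eval_ttm (truncation M t) e s' = eval_gtm M (with_top t e) l'"
    "eval_ttm (truncation N u) f s' = eval_gtm N (with_top u f) l'" by auto
  have "Pos (gsub (GVar 0) (GAdd l l')) \<in> A" using TAdd.prems l(1,2) by auto
  from tagree_le[OF assms(1) this] show ?case
    using l by (cases "le M (eval_gtm M (with_top t e) (GAdd l l')) t")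
      (force simp: truncation_def)+
qed (auto simp: truncation_def)

lemma tagree_forth:
  assumes "finite A"
  shows "\<exists>B. finite B \<and> (\<forall>e f. tagree B e f \<longrightarrow> (\<forall>a\<in>carrier (truncation M t).
           \<exists>b\<in>carrier (truncation N u). tagree A (e(x := a)) (f(x := b))))"
proof -
  \<comment> \<open>The two added atoms express that the new element lies in \<open>[0,t]\<close>;
    they force its match, a priori just an element of N, into \<open>[0,u]\<close>.\<close>
  let ?A = "A \<union> {Pos (GVar (Suc x)), Pos (gsub (GVar 0) (GVar (Suc x)))}"
  have "finite ?A" using assms by simp
  from agree_forth[OF M N this, of "Suc x"] obtain B where B: "finite B"
    "\<And>e f a. range e \<subseteq> carrier M \<Longrightarrow> range f \<subseteq> carrier N \<Longrightarrow> agree B M e N f \<Longrightarrow> a \<in> carrier M \<Longrightarrow>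
       \<exists>b\<in>carrier N. agree ?A M (e(Suc x := a)) N (f(Suc x := b))" by meson
  have upd: "(with_top c g)(Suc x := d) = with_top c (g(x := d))" for c d :: 'c and g
    by (auto split: nat.splits)
  have "\<exists>b\<in>carrier (truncation N u). tagree A (e(x := a)) (f(x := b))"
    if ef: "tagree B e f" and a: "a \<in> carrier (truncation M t)" for e f a
  proof -
    have "a \<in> carrier M" using a by (simp add: truncation_def)
    then obtain b where b: "b \<in> carrier N"
      "agree ?A M (with_top t (e(x := a))) N (with_top u (f(x := b)))"
      using B(2)[OF range_with_top[OF ef], of a] ef unfolding tagree_def upd by blast
    have "le N (zero N) b"
      using b a by (auto simp: agree_def truncation_def)
    moreover have "le M (zero M) (add M t (neg M a)) \<longleftrightarrow> le N (zero N) (add N u (neg N b))"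
      using b(2) by (auto simp: agree_def)
    then have "le N b u"
      using M.le_iff[of a t] N.le_iff[of b u] a b(1) t u by (simp add: truncation_def)
    ultimately have "b \<in> carrier (truncation N u)" using b by (simp add: truncation_def)
    moreover from this have "tagree A (e(x := a)) (f(x := b))"
      using ef a agree_mono[OF _ b(2), of A] by (auto simp: tagree_def)
    ultimately show ?thesis by blast
  qed
  then show ?thesis using B(1) by blast
qed

end

text \<open>Turns the forth property, with the two groups exchanged, into the back property.\<close>

lemma tagree_sym:
  assumes "zgroup M" "zgroup N" "t \<in> carrier M" "u \<in> carrier N"
  shows "tagree M t N u A e f \<longleftrightarrow> tagree N u M t A f e"
  using agree_sym[of A M _ N] by (auto simp: tagree_def[OF assms] tagree_def[OF assms(2,1,4,3)])

lemma tsat_agree: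
  assumes MN: "zgroup M" "zgroup N" and tu: "t \<in> carrier M" "u \<in> carrier N"
  shows "\<exists>A. finite A \<and> (\<forall>e f. tagree M t N u A e f \<longrightarrow>
           (tsat (truncation M t) e \<phi> \<longleftrightarrow> tsat (truncation N u) f \<phi>))"
  unfolding tsat_def
proof (rule sat_fm_back_and_forth)
  fix s s' :: ttm
  let ?A = "tests s \<union> tests s' \<union> (\<lambda>(l, l'). Pos (gsub l l')) ` (candidates s \<times> candidates s' \<union> candidates s' \<times> candidates s)"
  have fin: "finite ?A" by (simp add: finite_candidates finite_tests)
  note [simp] = truncation_def[THEN arg_cong[where f = le]]
  have main: "\<exists>l\<in>candidates s. \<exists>l'\<in>candidates s'.
    eval_ttm (truncation M t) e s = eval_gtm M (with_top t e) l \<and>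
    eval_ttm (truncation N u) f s = eval_gtm N (with_top u f) l \<and>
    eval_ttm (truncation M t) e s' = eval_gtm M (with_top t e) l' \<and>
    eval_ttm (truncation N u) f s' = eval_gtm N (with_top u f) l' \<and>
    Pos (gsub l l') \<in> ?A \<and> Pos (gsub l' l) \<in> ?A" if "tagree M t N u ?A e f" for e f
    using eval_truncation[OF MN tu that, of s] eval_truncation[OF MN tu that, of s'] by fast
  have "eval_ttm (truncation M t) e s = eval_ttm (truncation M t) e s' \<longleftrightarrow>
      eval_ttm (truncation N u) f s = eval_ttm (truncation N u) f s'"
      "le (truncation M t) (eval_ttm (truncation M t) e s) (eval_ttm (truncation M t) e s') \<longleftrightarrow>
       le (truncation N u) (eval_ttm (truncation N u) f s) (eval_ttm (truncation N u) f s')"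
    if ef: "tagree M t N u ?A e f" for e f
  proof -
    from main[OF ef] obtain l l' where
      "eval_ttm (truncation M t) e s = eval_gtm M (with_top t e) l"
      "eval_ttm (truncation N u) f s = eval_gtm N (with_top u f) l"
      "eval_ttm (truncation M t) e s' = eval_gtm M (with_top t e) l'"
      "eval_ttm (truncation N u) f s' = eval_gtm N (with_top u f) l'"
      "Pos (gsub l l') \<in> ?A" "Pos (gsub l' l) \<in> ?A" by metis
    then show "eval_ttm (truncation M t) e s = eval_ttm (truncation M t) e s' \<longleftrightarrow>
      eval_ttm (truncation N u) f s = eval_ttm (truncation N u) f s'"
      "le (truncation M t) (eval_ttm (truncation M t) e s) (eval_ttm (truncation M t) e s') \<longleftrightarrow>
       le (truncation N u) (eval_ttm (truncation N u) f s) (eval_ttm (truncation N u) f s')"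
      using tagree_eq[OF MN tu ef] tagree_le[OF MN tu ef] by auto
  qed
  then show
    "\<exists>A. finite A \<and> (\<forall>e f. tagree M t N u A e f \<longrightarrow>
      (eval_ttm (truncation M t) e s = eval_ttm (truncation M t) e s') =
      (eval_ttm (truncation N u) f s = eval_ttm (truncation N u) f s'))"
    "\<exists>A. finite A \<and> (\<forall>e f. tagree M t N u A e f \<longrightarrow>
      le (truncation M t) (eval_ttm (truncation M t) e s) (eval_ttm (truncation M t) e s') =
      le (truncation N u) (eval_ttm (truncation N u) f s) (eval_ttm (truncation N u) f s'))"
    using fin by (intro exI[of _ ?A] conjI allI impI; blast)+
next
  fix A x assume A: "finite (A :: atom set)"
  show "\<exists>B. finite B \<and> (\<forall>e f. tagree M t N u B e f \<longrightarrow> (\<forall>a\<in>carrier (truncation M t).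
      \<exists>b\<in>carrier (truncation N u). tagree M t N u A (e(x := a)) (f(x := b))))"
    using tagree_forth[OF MN tu A] .
  show "\<exists>B. finite B \<and> (\<forall>e f. tagree M t N u B e f \<longrightarrow> (\<forall>b\<in>carrier (truncation N u).
      \<exists>a\<in>carrier (truncation M t). tagree M t N u A (e(x := a)) (f(x := b))))"
    using tagree_forth[OF MN(2,1) tu(2,1) A, of x] unfolding tagree_sym[OF MN tu] by blast
qed (use MN tu in \<open>auto simp: tagree_def intro: agree_mono\<close>)

section \<open>Atoms about the penultimate element\<close>

primrec gsubst :: "(nat \<Rightarrow> gtm) \<Rightarrow> gtm \<Rightarrow> gtm" where
  "gsubst \<sigma> (GVar x) = \<sigma> x"
| "gsubst \<sigma> GZero = GZero"
| "gsubst \<sigma> GOne = GOne"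
| "gsubst \<sigma> (GAdd s t) = GAdd (gsubst \<sigma> s) (gsubst \<sigma> t)"
| "gsubst \<sigma> (GNeg s) = GNeg (gsubst \<sigma> s)"

lemma eval_gsubst: "eval_gtm M e (gsubst \<sigma> s) = eval_gtm M (\<lambda>x. eval_gtm M e (\<sigma> x)) s"
  by (induction s) simp_all

lemma fv_gsubst: "fv_gtm (gsubst \<sigma> s) = (\<Union>x\<in>fv_gtm s. fv_gtm (\<sigma> x))"
  by (induction s) auto

text \<open>Under a constant assignment a term and its collapse have the same value, while only
  variable 0 is left, as formulas of a 1-type require.\<close>

abbreviation "collapse \<equiv> gsubst (\<lambda>_. GVar 0)"

primrec map_atom :: "(gtm \<Rightarrow> gtm) \<Rightarrow> atom \<Rightarrow> atom" where
  "map_atom h (Pos s) = Pos (h s)"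
| "map_atom h (Dvd n s) = Dvd n (h s)"

text \<open>After collapsing, variable 1 is fresh and can name the quotient.\<close>

primrec atom_fm :: "atom \<Rightarrow> gtm fm" where
  "atom_fm (Pos s) = Le GZero (collapse s)"
| "atom_fm (Dvd n s) =
     (if 0 < n then Ex 1 (Eq (collapse s) (gmul n (GVar 1))) else Neg (Eq GZero GZero))"

lemma atom_fm_fm1: "atom_fm \<alpha> \<in> fm1"
  using fv_gmul[of _ "GVar 1"] by (cases \<alpha>) (auto simp: fm1_def fv_gsubst)

lemma gsat1_atom_fm: "gsat1 M a (atom_fm \<alpha>) \<longleftrightarrow> holds M (\<lambda>_. a) \<alpha>"
  by (cases \<alpha>) (simp_all add: gsat1_def gsat_def eval_gsubst gdvd_def)

text \<open>The constant 1 of S is carried into \<open>[0,t]\<close> by the isomorphism. This makes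
  the penultimate element nonnegative.\<close>

lemma (in zgroup) toag_one_le:
  assumes "is_tstr S" "tstr_iso h S (truncation M t)"
  shows "\<one> \<preceq> t"
proof -
  have "one (truncation M t) \<in> carrier (truncation M t)"
    using assms by (metis bij_betwE is_tstr_def tstr_iso_def)
  then show ?thesis by (simp add: truncation_def)
qed

lemma toag_elem_equiv:
  assumes S: "presburger_toag M t S" and T: "presburger_toag N u T"
    and pq: "\<And>\<alpha>. holds M (\<lambda>_. penult M t) \<alpha> \<longleftrightarrow> holds N (\<lambda>_. penult N u) \<alpha>"
  shows "elem_equiv S T"
proof -
  interpret M: zgroup M using S model_imp_zgroup by (auto simp: presburger_toag_def)
  interpret N: zgroup N using T model_imp_zgroup by (auto simp: presburger_toag_def)
  have t: "t \<in> carrier M" "le M (zero M) t" and u: "u \<in> carrier N" "le N (zero N) u"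
    using S T by (auto simp: presburger_toag_def)
  have MN: "zgroup M" "zgroup N" by unfold_locales
  \<comment> \<open>The top is the penultimate element plus 1, and all other variables are set to 0.
    Substituting this way turns atoms about the initial assignment of the truncation into atoms
    about the penultimate element.\<close>
  define \<sigma> where "\<sigma> = case_nat (GAdd (GVar 0) GOne) (\<lambda>_. GZero)"
  have \<sigma>: "(\<lambda>x. eval_gtm K (\<lambda>_. penult K v) (\<sigma> x)) = with_top v (\<lambda>_. zero K)"
    if "zgroup K" "v \<in> carrier K" for K :: "'k gstr" and v
  proof
    fix x
    interpret zgroup K by fact
    show "eval_gtm K (\<lambda>_. penult K v) (\<sigma> x) = with_top v (\<lambda>_. zero K) x"
      using that by (cases x) (simp_all add: \<sigma>_def penult_def add_assoc add_comm[of "neg K (one K)"])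
  qed
  have shift: "holds K (with_top v (\<lambda>_. zero K)) \<alpha> \<longleftrightarrow> holds K (\<lambda>_. penult K v) (map_atom (gsubst \<sigma>) \<alpha>)"
    if "zgroup K" "v \<in> carrier K" for K :: "'k gstr" and v \<alpha>
    by (cases \<alpha>) (simp_all add: eval_gsubst \<sigma>[OF that])
  have "elem_equiv (truncation M t) (truncation N u)"
    unfolding elem_equiv_def
  proof (intro allI impI)
    fix \<phi> :: "ttm fm" assume \<phi>: "fv_fm fv_ttm \<phi> = {}"
    obtain A where A: "\<And>e f. tagree M t N u A e f \<Longrightarrow>
        tsat (truncation M t) e \<phi> \<longleftrightarrow> tsat (truncation N u) f \<phi>"
      using tsat_agree[OF MN t(1) u(1), of \<phi>] by blast
    have 1: "range (\<lambda>_. zero M) \<subseteq> carrier (truncation M t)"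
      and 2: "range (\<lambda>_. zero N) \<subseteq> carrier (truncation N u)"
      using t u by (auto simp: truncation_def)
    have "tagree M t N u A (\<lambda>_. zero M) (\<lambda>_. zero N)"
      unfolding tagree_def[OF MN t(1) u(1)] agree_def
      using 1 2 shift[OF MN(1) t(1)] shift[OF MN(2) u(1)] pq by blast
    from A[OF this] show "ttrue (truncation M t) \<phi> \<longleftrightarrow> ttrue (truncation N u) \<phi>"
      by (simp only: ttrue_sentence[OF \<phi> 1] ttrue_sentence[OF \<phi> 2])
  qed
  moreover have "elem_equiv S (truncation M t)" "elem_equiv T (truncation N u)"
    using S T iso_elem_equiv by (auto simp: presburger_toag_def)
  ultimately show ?thesis by (simp add: elem_equiv_def)
qed

section \<open>Remainders and standardness determine the atoms\<close>

context zgroup begin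

text \<open>The value is \<open>k p + m\<close> with integers k and m read off the term alone, hence
  the same in every Z-group.\<close>

lemma eval_constant_env:
  assumes "p \<in> G"
  shows "eval_gtm M (\<lambda>_. p) s = coef 0 (collapse s) \<cdot> p \<oplus>
           eval_gtm int_gstr (\<lambda>_. 0) (rest 0 (collapse s)) \<cdot> \<one>"
proof -
  have "eval_gtm M (\<lambda>_. p) s = eval_gtm M ((\<lambda>_. \<zero>)(0 := p)) (collapse s)"
    by (simp add: eval_gsubst)
  also have "\<dots> = coef 0 (collapse s) \<cdot> p \<oplus> eval_gtm M (\<lambda>_. \<zero>) (rest 0 (collapse s))"
    using assms by (intro eval_upd) auto
  also have "eval_gtm M (\<lambda>_. \<zero>) (rest 0 (collapse s)) =
      eval_gtm int_gstr (\<lambda>_. 0) (rest 0 (collapse s)) \<cdot> \<one>"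
    using eval_numerals[of "\<lambda>_. 0"] by simp
  finally show ?thesis .
qed

text \<open>A nonnegative nonstandard \<open>p\<close> exceeds every integer, so the sign of
  \<open>k p + m\<close> is decided lexicographically.\<close>

lemma nonstandard_pos:
  assumes p: "p \<in> G" "\<zero> \<preceq> p" and ns: "\<And>k. p \<noteq> mult M k \<one>"
  shows "\<zero> \<preceq> k \<cdot> p \<oplus> m \<cdot> \<one> \<longleftrightarrow> 0 < k \<or> k = 0 \<and> 0 \<le> m"
proof -
  have pos: "\<zero> \<preceq> k \<cdot> p \<oplus> m \<cdot> \<one>" if "0 < k" for k m
  proof -
    have "\<not> p \<preceq> int (nat \<bar>m\<bar>) \<cdot> \<one>"
      using standard_below[OF p] ns by (auto simp: smul_def)
    then have "\<zero> \<preceq> p \<oplus> \<ominus> (\<bar>m\<bar> \<cdot> \<one>)"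
      using le_total[of p "\<bar>m\<bar> \<cdot> \<one>"] le_iff[of "\<bar>m\<bar> \<cdot> \<one>" p] p by auto
    moreover have "\<zero> \<preceq> (\<bar>m\<bar> + m) \<cdot> \<one>" by (simp add: pos_scale_one)
    moreover have "\<zero> \<preceq> (k - 1) \<cdot> p" using that p by (intro pos_scale) auto
    \<comment> \<open>The element \<open>k p + m\<close> is split into three nonnegative summands,
      using one copy of \<open>p\<close> to absorb \<open>|m|\<close>.\<close>
    ultimately have "\<zero> \<preceq> (k - 1) \<cdot> p \<oplus> (p \<oplus> \<ominus> (\<bar>m\<bar> \<cdot> \<one>) \<oplus> (\<bar>m\<bar> + m) \<cdot> \<one>)"
      using p by (simp add: pos_add)
    also have "\<dots> = k \<cdot> p \<oplus> m \<cdot> \<one>"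
      using p scale_succ[of p "k - 1"] by (simp add: add_scale add_assoc add_lcomm[of p])
    finally show ?thesis .
  qed
  consider "0 < k" | "k = 0" | "k < 0" by linarith
  then show ?thesis
  proof cases
    case 3
    \<comment> \<open>By \<open>not_pos\<close>, negativity of \<open>k p + m\<close> is
      nonnegativity of \<open>- k p - m - 1\<close>, which has a positive leading
      coefficient.\<close>
    have "\<ominus> (k \<cdot> p \<oplus> m \<cdot> \<one>) \<oplus> \<ominus> \<one> = (- k) \<cdot> p \<oplus> (- m - 1) \<cdot> \<one>"
      using p add_scale[of \<one> "- m" "- 1"] by (simp add: neg_add scale_neg add_assoc)
    then have "\<not> \<zero> \<preceq> k \<cdot> p \<oplus> m \<cdot> \<one>"
      using not_pos[of "k \<cdot> p \<oplus> m \<cdot> \<one>"] pos[of "- k" "- m - 1"] p 3 by simp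
    then show ?thesis using 3 by simp
  qed (use pos p in \<open>auto simp: pos_scale_one\<close>)
qed

lemma remainder_dvd:
  assumes p: "p \<in> G" and r: "has_remainder M p (nat n) r" and n: "0 < n"
  shows "n dvdg k \<cdot> p \<oplus> m \<cdot> \<one> \<longleftrightarrow> n dvd k * int r + m"
proof -
  obtain q where q: "q \<in> G" "p = n \<cdot> q \<oplus> int r \<cdot> \<one>"
    using r n by (auto simp: has_remainder_def smul_def)
  have "k \<cdot> p \<oplus> m \<cdot> \<one> = (k * n) \<cdot> q \<oplus> (k * int r + m) \<cdot> \<one>"
    using q(1) by (simp add: q(2) scale_add scale_scale add_scale add_assoc)
  then show ?thesis using dvd_add_iff[OF dvd_scale] q n by (simp add: dvd_one)
qed

lemma penult_pos: 
  assumes "presburger_toag M t S" shows "penult M t \<in> G" "\<zero> \<preceq> penult M t"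
proof -
  have "t \<in> G" "\<one> \<preceq> t" using assms toag_one_le by (auto simp: presburger_toag_def)
  then show "penult M t \<in> G" "\<zero> \<preceq> penult M t"
    using le_iff[of \<one> t] by (simp_all add: penult_def)
qed

end

text \<open>Standard penultimate elements are the same numeral, and their atoms can be evaluated in
  the integers. For nonstandard ones, comparisons depend on the coefficients only and divisibilities
  on the remainders.\<close>

lemma remainders_holds:
  assumes S: "presburger_toag M t S" and T: "presburger_toag N u T"
    and std: "(\<exists>k. penult M t = mult M k (one M)) \<longleftrightarrow> (\<exists>k. penult N u = mult N k (one N))"
    and eq: "\<And>k l. penult M t = mult M k (one M) \<Longrightarrow> penult N u = mult N l (one N) \<Longrightarrow> k = l"
    and rem: "\<And>n. 0 < n \<Longrightarrow> \<exists>r. has_remainder M (penult M t) n r \<and> has_remainder N (penult N u) n r"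
  shows "holds M (\<lambda>_. penult M t) \<alpha> \<longleftrightarrow> holds N (\<lambda>_. penult N u) \<alpha>"
proof -
  interpret M: zgroup M using S model_imp_zgroup by (auto simp: presburger_toag_def)
  interpret N: zgroup N using T model_imp_zgroup by (auto simp: presburger_toag_def)
  note p = M.penult_pos[OF S] and q = N.penult_pos[OF T]
  show ?thesis
  proof (cases "\<exists>k. penult M t = mult M k (one M)")
    case True
    then obtain k where k: "penult M t = smul M (int k) (one M)" "penult N u = smul N (int k) (one N)"
      using std eq by (auto simp: smul_def)
    show ?thesis
      unfolding k using M.holds_numerals[of "\<lambda>_. int k"] N.holds_numerals[of "\<lambda>_. int k"] by simp
  next
    case False
    show ?thesis
    proof (cases \<alpha>)
      case (Pos s)
      then show ?thesis
        using False std p q by (simp add: M.eval_constant_env N.eval_constant_env M.nonstandard_pos N.nonstandard_pos)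
    next
      case (Dvd n s)
      show ?thesis
      proof (cases "0 < n")
        case True
        then obtain r where "has_remainder M (penult M t) (nat n) r" "has_remainder N (penult N u) (nat n) r"
          using rem[of "nat n"] by auto
        then show ?thesis
          using True p q by (simp add: Dvd M.eval_constant_env N.eval_constant_env M.remainder_dvd N.remainder_dvd)
      qed (simp add: Dvd)
    qed
  qed
qed

section \<open>Realizing types\<close>

instance gtm :: countable by countable_datatype
instance fm :: (countable) countable by countable_datatype

text \<open>Both the integers and the pairs of rationals used below are countable; relabelling
  brings either realization to the type \<open>nat\<close>.\<close>

definition encode :: "'a::countable gstr \<Rightarrow> nat gstr" where
  "encode M =
     \<lparr>carrier = to_nat ` carrier M, le = (\<lambda>a b. le M (from_nat a) (from_nat b)),
      zero = to_nat (zero M), one = to_nat (one M),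
      add = (\<lambda>a b. to_nat (add M (from_nat a) (from_nat b))),
      neg = (\<lambda>a. to_nat (neg M (from_nat a)))\<rparr>"

lemma eval_encode: "eval_gtm (encode M) (\<lambda>x. to_nat (e x)) s = to_nat (eval_gtm M e s)"
  by (induction s) (simp_all add: encode_def)

lemma gsat_encode:
  assumes "is_gstr M" "range e \<subseteq> carrier M"
  shows "gsat M e \<phi> \<longleftrightarrow> gsat (encode M) (\<lambda>x. to_nat (e x)) \<phi>"
  unfolding gsat_def
proof (rule sat_fm_iso)
  show "bij_betw to_nat (carrier M) (carrier (encode M))"
    by (auto simp: encode_def intro!: inj_on_imp_bij_betw inj_on_subset[OF inj_to_nat])
  fix e :: "nat \<Rightarrow> 'a" and s assume "range e \<subseteq> carrier M"
  then have "eval_gtm M e s \<in> carrier M" using assms(1) by (induction s) (auto simp: is_gstr_def)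
  then show "eval_gtm M e s \<in> carrier M \<and>
      eval_gtm (encode M) (\<lambda>x. to_nat (e x)) s = to_nat (eval_gtm M e s)"
    by (simp add: eval_encode)
qed (use assms in \<open>auto simp: encode_def\<close>)

lemma encode_model:
  assumes M: "presburger_model M" shows "presburger_model (encode M)"
proof -
  have gstr: "is_gstr M" using M by (simp add: presburger_model_def)
  then have e: "range (\<lambda>_. zero M) \<subseteq> carrier M" by (auto simp: is_gstr_def)
  then have e': "range (\<lambda>_. to_nat (zero M)) \<subseteq> carrier (encode M)" by (auto simp: encode_def)
  have "gtrue (encode M) \<phi>" if \<phi>: "\<phi> \<in> presburger" for \<phi>
  proof -
    have s: "fv_fm fv_gtm \<phi> = {}" using \<phi> by (simp add: presburger_def)
    have "gtrue M \<phi>" using \<phi> M by (simp add: presburger_model_def)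
    then show ?thesis
      using gtrue_sentence[OF s e] gtrue_sentence[OF s e'] gsat_encode[OF gstr e] by simp
  qed
  moreover have "is_gstr (encode M)" using gstr by (auto simp: is_gstr_def encode_def)
  ultimately show ?thesis by (simp add: presburger_model_def)
qed

lemma (in zgroup) toag_of_nonneg:
  assumes b: "b \<in> G" "\<zero> \<preceq> b"
  shows "presburger_toag M (b \<oplus> \<one>) (truncation M (b \<oplus> \<one>))" "penult M (b \<oplus> \<one>) = b"
proof -
  define t where "t = b \<oplus> \<one>"
  have t: "t \<in> G" using b by (simp add: t_def)
  have t1: "\<one> \<preceq> t" using le_add[of \<zero> b \<one>] b by (simp add: t_def)
  have t0: "\<zero> \<preceq> t" using le_trans[OF _ _ t zero_le_one t1] by simp
  have "tstr_iso id (truncation M t) (truncation M t)"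
    by (simp add: tstr_iso_def)
  moreover have "is_tstr (truncation M t)"
    using t t0 t1 zero_le_one pos_add by (auto simp: is_tstr_def truncation_def)
  moreover have "presburger_model M" by (rule zgroup_imp_model) unfold_locales
  ultimately show "presburger_toag M (b \<oplus> \<one>) (truncation M (b \<oplus> \<one>))"
    using t t0 by (auto simp: presburger_toag_def t_def)
  show "penult M (b \<oplus> \<one>) = b" using b by (simp add: penult_def add_assoc)
qed

lemma toag_of_realization:
  fixes M :: "'a::countable gstr"
  assumes M: "zgroup M" and a: "realizes M a p" and le: "Le GZero (GVar 0) \<in> p"
  shows "\<exists>(N :: nat gstr) t (S :: nat tstr). presburger_toag N t S \<and> realizes N (penult N t) p"
proof -
  define b where "b = to_nat a"
  have M': "presburger_model M" by (rule zgroup_imp_model[OF M])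
  have N: "zgroup (encode M)" by (rule model_imp_zgroup[OF encode_model[OF M']])
  have "range (\<lambda>_. a) \<subseteq> carrier M" using a by (auto simp: realizes_def)
  then have real: "realizes (encode M) b p"
    using a gsat_encode[of M "\<lambda>_. a"] M'
    by (auto simp: realizes_def gsat1_def presburger_model_def b_def encode_def[THEN arg_cong[where f = carrier]])
  then have "b \<in> carrier (encode M)" "le (encode M) (zero (encode M)) b"
    using le by (auto simp: realizes_def gsat1_def gsat_def)
  from zgroup.toag_of_nonneg[OF N this] real show ?thesis by metis
qed

text \<open>
  A pair \<open>(q, s)\<close> stands for the polynomial \<open>q X + s\<close>, which is evaluated along the sequence \<open>z\<close>.
\<close>

definition line :: "(nat \<Rightarrow> int) \<Rightarrow> rat \<times> rat \<Rightarrow> nat \<Rightarrow> rat" where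
  "line z x i = fst x * of_int (z i) + snd x"

text \<open>Rational coefficients supply the quotients needed for division. When z tends to
  infinity, the lexicographic order is the eventual order of the values along z.\<close>

definition lines :: "(nat \<Rightarrow> int) \<Rightarrow> (rat \<times> rat) gstr" where
  "lines z =
     \<lparr>carrier = {x. \<forall>\<^sub>F i in sequentially. line z x i \<in> \<int>},
      le = (\<lambda>x y. fst x < fst y \<or> fst x = fst y \<and> snd x \<le> snd y),
      zero = (0, 0), one = (0, 1), add = (\<lambda>x y. (fst x + fst y, snd x + snd y)),
      neg = (\<lambda>x. (- fst x, - snd x))\<rparr>"

lemma lines_sel [simp]:
  "x \<in> carrier (lines z) \<longleftrightarrow> (\<forall>\<^sub>F i in sequentially. line z x i \<in> \<int>)"
  "le (lines z) x y \<longleftrightarrow> fst x < fst y \<or> fst x = fst y \<and> snd x \<le> snd y"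
  "zero (lines z) = (0, 0)" "one (lines z) = (0, 1)"
  "add (lines z) x y = (fst x + fst y, snd x + snd y)"
  "neg (lines z) x = (- fst x, - snd x)"
  by (simp_all add: lines_def)

lemma smul_lines [simp]: "smul (lines z) k x = (of_int k * fst x, of_int k * snd x)"
proof -
  have "mult (lines z) n x = (of_nat n * fst x, of_nat n * snd x)" for n
    by (induction n) (simp_all add: algebra_simps)
  then show ?thesis by (simp add: smul_def)
qed

lemma line_simps [simp]:
  "line z (0, s) i = s"
  "line z (fst x + fst y, snd x + snd y) i = line z x i + line z y i"
  "line z (- fst x, - snd x) i = - line z x i"
  by (simp_all add: line_def algebra_simps)

text \<open>With a common denominator D the value at i is \<open>w i / D\<close>, where
  \<open>w i\<close> is an integer linear in \<open>z i\<close>. A constant residue of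
  \<open>z i\<close> modulo \<open>n * D\<close> gives \<open>w i\<close> a constant residue c;
  integrality forces D to divide c, and the value has residue \<open>c div D\<close> modulo
  n.\<close>

lemma lines_division:
  assumes res: "\<And>n. 0 < n \<Longrightarrow> \<exists>r. \<forall>\<^sub>F i in sequentially. n dvd z i - r"
    and x: "\<forall>\<^sub>F i in sequentially. line z x i \<in> \<int>" and n: "0 < n"
  shows "\<exists>r. \<forall>\<^sub>F i in sequentially. (line z x i - of_int r) / of_int n \<in> \<int>"
proof -
  obtain a d where d: "0 < d" "fst x = of_int a / of_int d"
    by (metis Fract_of_int_quotient Rat_cases)
  obtain b d' where d': "0 < d'" "snd x = of_int b / of_int d'"
    by (metis Fract_of_int_quotient Rat_cases)
  define D where "D = d * d'"
  have D: "0 < D" using d d' by (simp add: D_def)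
  define w where "w i = a * d' * z i + b * d" for i
  have w: "line z x i * of_int D = of_int (w i)" for i
    unfolding line_def D_def w_def d(2) d'(2) using d(1) d'(1) by (simp add: field_simps)
  obtain r where r: "\<forall>\<^sub>F i in sequentially. n * D dvd z i - r"
    using res[of "n * D"] n D by auto
  define c where "c = a * d' * r + b * d"
  have wc: "w i - c = a * d' * (z i - r)" for i by (simp add: w_def c_def algebra_simps)
  have ev: "\<forall>\<^sub>F i in sequentially. n * D dvd w i - c"
    using r by eventually_elim (simp add: wc)
  have "\<forall>\<^sub>F i in sequentially. D dvd c \<and> (line z x i - of_int (c div D)) / of_int n \<in> \<int>"
    using ev x
  proof eventually_elim
    case (elim i)
    from elim(1) obtain k where k: "w i - c = n * D * k" by (elim dvdE)
    from elim(2) obtain m where m: "line z x i = of_int m" by (elim Ints_cases)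
    have "(of_int (m * D) :: rat) = of_int (w i)" using w[of i] m by simp
    then have "w i = m * D" by (simp only: of_int_eq_iff)
    then have c: "c = D * (m - n * k)" using k by (simp add: algebra_simps)
    then have "c div D = m - n * k" using D by simp
    then have "(line z x i - of_int (c div D)) / of_int n = of_int k" using n by (simp add: m)
    then show ?case using c by simp
  qed
  then show ?thesis by (intro exI[of _ "c div D"]) (auto elim: eventually_mono)
qed

lemma zgroup_lines:
  assumes res: "\<And>n. 0 < n \<Longrightarrow> \<exists>r. \<forall>\<^sub>F i in sequentially. n dvd z i - r"
  shows "zgroup (lines z)"
proof
  fix a b assume "a \<in> carrier (lines z)" "b \<in> carrier (lines z)"
  then have "\<forall>\<^sub>F i in sequentially. line z a i \<in> \<int>" "\<forall>\<^sub>F i in sequentially. line z b i \<in> \<int>" by simp_all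
  then show "add (lines z) a b \<in> carrier (lines z)" by (auto elim: eventually_elim2)
next
  fix a assume "a \<in> carrier (lines z)" "le (lines z) (zero (lines z)) a" "a \<noteq> zero (lines z)"
  \<comment> \<open>If the leading coefficient is 0, the values are constant, so the constant term
    is an integer; otherwise the element exceeds 1 lexicographically.\<close>
  then show "le (lines z) (one (lines z)) a"
    by (cases a) (auto elim!: Ints_cases)
next
  fix a and n :: int assume a: "a \<in> carrier (lines z)" and n: "0 < n"
  obtain r where r: "\<forall>\<^sub>F i in sequentially. (line z a i - of_int r) / of_int n \<in> \<int>"
    using lines_division[OF res, of a n] a n by auto
  define q where "q = (fst a / of_int n, (snd a - of_int (r mod n)) / of_int n)"
  \<comment> \<open>Replacing r by its remainder modulo n changes the quotient by the integer
    \<open>r div n\<close>, which preserves eventual integrality.\<close>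
  have "line z q i = (line z a i - of_int r) / of_int n + of_int (r div n)" for i
  proof -
    have "(of_int r :: rat) = of_int n * of_int (r div n) + of_int (r mod n)"
      by (metis mult_div_mod_eq of_int_add of_int_mult)
    then show ?thesis using n by (simp add: line_def q_def field_simps)
  qed
  then have "q \<in> carrier (lines z)" using r by simp
  moreover have "a = add (lines z) (smul (lines z) n q) (smul (lines z) (r mod n) (one (lines z)))"
    using n by (cases a) (simp add: q_def)
  ultimately show "\<exists>q\<in>carrier (lines z). \<exists>r\<ge>0. r < n \<and>
      a = add (lines z) (smul (lines z) n q) (smul (lines z) r (one (lines z)))"
    using n by (intro bexI[of _ q] exI[of _ "r mod n"]) (auto simp: pos_mod_bound)
qed (auto simp: prod_eq_iff)

lemma line_eval:
  "line z (eval_gtm (lines z) (\<lambda>_. (1, 0)) s) i = of_int (eval_gtm int_gstr (\<lambda>_. z i) s)"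
  by (induction s) (simp_all add: line_def algebra_simps)

text \<open>Once \<open>z i\<close> exceeds \<open>|s / q|\<close>, the leading coefficient q
  decides the sign of \<open>q z i + s\<close>.\<close>

lemma lines_pos:
  assumes lim: "\<And>k. \<forall>\<^sub>F i in sequentially. k \<le> z i"
  shows "\<forall>\<^sub>F i in sequentially. le (lines z) (zero (lines z)) x \<longleftrightarrow> 0 \<le> line z x i"
proof -
  consider "fst x = 0" | "fst x \<noteq> 0" by blast
  then show ?thesis
  proof cases
    case 1
    then show ?thesis by (simp add: line_def)
  next
    case 2
    show ?thesis
      using lim[of "\<lceil>\<bar>snd x / fst x\<bar>\<rceil> + 1"]
    proof eventually_elim
      case (elim i)
      then have "\<bar>snd x / fst x\<bar> < of_int (z i)" by linarith
      then have "\<bar>snd x\<bar> < \<bar>fst x\<bar> * of_int (z i)" using 2 by (simp add: field_simps)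
      then show ?case using 2 by (auto simp: line_def abs_if split: if_splits)
    qed
  qed
qed

text \<open>Divisibility by n in the group means that n eventually divides the values. Its failure
  alone would give non-divisibility only for infinitely many i; the assumption \<open>dec\<close>
  excludes such oscillation.\<close>

lemma holds_lines:
  assumes lim: "\<And>k. \<forall>\<^sub>F i in sequentially. k \<le> z i"
    and dec: "(\<forall>\<^sub>F i in sequentially. holds int_gstr (\<lambda>_. z i) \<alpha>) \<or>
              (\<forall>\<^sub>F i in sequentially. \<not> holds int_gstr (\<lambda>_. z i) \<alpha>)"
  shows "\<forall>\<^sub>F i in sequentially. holds (lines z) (\<lambda>_. (1, 0)) \<alpha> \<longleftrightarrow> holds int_gstr (\<lambda>_. z i) \<alpha>"
proof (cases \<alpha>)
  case (Pos s)
  show ?thesis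
    using lines_pos[OF lim, of "eval_gtm (lines z) (\<lambda>_. (1, 0)) s"]
    by eventually_elim (simp add: Pos line_eval del: lines_sel)
next
  case (Dvd n s)
  define x where "x = eval_gtm (lines z) (\<lambda>_. (1, 0)) s"
  define w where "w i = eval_gtm int_gstr (\<lambda>_. z i) s" for i
  have "gdvd (lines z) n x \<longleftrightarrow> (\<forall>\<^sub>F i in sequentially. n dvd w i)" if n: "0 < n"
  proof -
    \<comment> \<open>The quotient by n is unique among pairs of rationals, so it only has to be
      checked whether it lies in the carrier.\<close>
    have "gdvd (lines z) n x \<longleftrightarrow> (fst x / of_int n, snd x / of_int n) \<in> carrier (lines z)"
      unfolding gdvd_def using n by (force simp del: lines_sel(1))
    also have "\<dots> \<longleftrightarrow> (\<forall>\<^sub>F i in sequentially. n dvd w i)"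
    proof -
      have "line z (fst x / of_int n, snd x / of_int n) i = of_int (w i) / of_int n" for i
        using line_eval[of z s i] n by (simp add: line_def x_def w_def field_simps)
      moreover have "(of_int k / of_int n :: rat) \<in> \<int> \<longleftrightarrow> n dvd k" for k
        using n by (simp add: of_int_div_of_int_in_Ints_iff)
      ultimately show ?thesis by simp
    qed
    finally show ?thesis .
  qed
  then have iff: "holds (lines z) (\<lambda>_. (1, 0)) \<alpha> \<longleftrightarrow> (\<forall>\<^sub>F i in sequentially. holds int_gstr (\<lambda>_. z i) \<alpha>)"
    by (cases "0 < n") (simp_all add: Dvd x_def w_def)
  from dec show ?thesis
  proof
    assume "\<forall>\<^sub>F i in sequentially. holds int_gstr (\<lambda>_. z i) \<alpha>"
    with iff show ?thesis by simp
  next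
    assume *: "\<forall>\<^sub>F i in sequentially. \<not> holds int_gstr (\<lambda>_. z i) \<alpha>"
    have "\<not> holds (lines z) (\<lambda>_. (1, 0)) \<alpha>"
    proof
      assume "holds (lines z) (\<lambda>_. (1, 0)) \<alpha>"
      then show False using eventually_happens[OF eventually_conj[OF _ *]] iff by auto
    qed
    with * show ?thesis by simp
  qed
qed

section \<open>Types as limits of integers\<close>

context
  fixes p
  assumes p: "complete_1_type p"
begin

text \<open>There are countably many formulas, so p is the union of an increasing sequence of finite
  parts; let \<open>z i\<close> realize the i-th.\<close>

lemma type_sequence:
  shows "\<exists>z. \<forall>\<phi>\<in>p. \<forall>\<^sub>F i in sequentially. gsat1 int_gstr (z i) \<phi>"
proof -
  have "\<exists>a. realizes int_gstr a {\<phi>\<in>p. to_nat \<phi> \<le> i}" for i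
  proof -
    have "finite {\<phi>\<in>p. to_nat \<phi> \<le> i}"
      by (rule inj_on_finite[of to_nat _ "{..i}"]) (auto intro: inj_on_subset[OF inj_to_nat])
    then show ?thesis using p unfolding complete_1_type_def by auto
  qed
  then obtain z where "\<And>i. realizes int_gstr (z i) {\<phi>\<in>p. to_nat \<phi> \<le> i}" by metis
  then have "gsat1 int_gstr (z i) \<phi>" if "\<phi> \<in> p" "to_nat \<phi> \<le> i" for \<phi> i
    using that by (auto simp: realizes_def)
  then show ?thesis by (intro exI[of _ z]) (auto simp: eventually_sequentially)
qed

lemma type_realized:
  assumes le: "Le GZero (GVar 0) \<in> p"
  shows "(\<exists>a. realizes int_gstr a p) \<or> (\<exists>z. zgroup (lines z) \<and> realizes (lines z) (1, 0) p)"
proof -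
  obtain z where z: "\<And>\<phi>. \<phi> \<in> p \<Longrightarrow> \<forall>\<^sub>F i in sequentially. gsat1 int_gstr (z i) \<phi>"
    using type_sequence by blast
  \<comment> \<open>By completeness p contains each formula or its negation, so no formula
    oscillates along the sequence.\<close>
  have dec: "(\<forall>\<^sub>F i in sequentially. gsat1 int_gstr (z i) \<phi>) \<or>
      (\<forall>\<^sub>F i in sequentially. \<not> gsat1 int_gstr (z i) \<phi>)" if "\<phi> \<in> fm1" for \<phi>
    using z[of \<phi>] z[of "Neg \<phi>"] p that by (auto simp: complete_1_type_def gsat1_def gsat_def)
  have decA: "(\<forall>\<^sub>F i in sequentially. holds int_gstr (\<lambda>_. z i) \<alpha>) \<or>
      (\<forall>\<^sub>F i in sequentially. \<not> holds int_gstr (\<lambda>_. z i) \<alpha>)" for \<alpha>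
    using dec[OF atom_fm_fm1, of \<alpha>] by (simp add: gsat1_atom_fm)
  show ?thesis
  proof (cases "\<exists>j. \<forall>\<^sub>F i in sequentially. z i = j")
    case True
    then obtain j where j: "\<forall>\<^sub>F i in sequentially. z i = j" by blast
    have "gsat1 int_gstr j \<phi>" if "\<phi> \<in> p" for \<phi>
      using eventually_happens[OF eventually_conj[OF j z[OF that]]] by auto
    then show ?thesis by (auto simp: realizes_def)
  next
    case False
    \<comment> \<open>For the formula \<open>x = j\<close>, not being eventually true means being
      eventually false. A nonnegative sequence that eventually avoids each j tends to
      infinity.\<close>
    have ne: "\<forall>\<^sub>F i in sequentially. z i \<noteq> j" for j
      using dec[of "Eq (GVar 0) (num j)"] False fv_gmul[of j GOne]
      by (auto simp: fm1_def gsat1_def gsat_def)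
    have nn: "\<forall>\<^sub>F i in sequentially. 0 \<le> z i" using z[OF le] by (simp add: gsat1_def gsat_def)
    have lim: "\<forall>\<^sub>F i in sequentially. k \<le> z i" for k
    proof -
      have "\<forall>\<^sub>F i in sequentially. \<forall>j\<in>{0..<k}. z i \<noteq> j" using ne by (intro eventually_ball_finite) auto
      with nn show ?thesis by eventually_elim force
    qed
    \<comment> \<open>If no residue were eventually constant, all the residues from 0 to n - 1 would
      be excluded at a common index.\<close>
    have res: "\<exists>r. \<forall>\<^sub>F i in sequentially. n dvd z i - r" if n: "0 < n" for n
    proof (rule ccontr)
      assume no: "\<not> ?thesis"
      have "\<forall>\<^sub>F i in sequentially. \<not> n dvd z i - r" for r
        using decA[of "Dvd n (gsub (GVar 0) (num r))"] no n by auto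
      then have "\<forall>\<^sub>F i in sequentially. \<forall>r\<in>{0..<n}. \<not> n dvd z i - r"
        by (intro eventually_ball_finite) auto
      then obtain i where "\<forall>r\<in>{0..<n}. \<not> n dvd z i - r" using eventually_happens by force
      then show False using n by (meson atLeastLessThan_iff dvd_minus_mod pos_mod_bound pos_mod_sign)
    qed
    have zg: "zgroup (lines z)" using zgroup_lines[OF res] .
    have X: "(1, 0) \<in> carrier (lines z)" by (simp add: line_def)
    have "gsat1 (lines z) (1, 0) \<phi>" if \<phi>: "\<phi> \<in> p" for \<phi>
    proof -
      obtain A where A: "finite A" "\<And>e f. range e \<subseteq> carrier (lines z) \<Longrightarrow> range f \<subseteq> carrier int_gstr \<Longrightarrow>
          agree A (lines z) e int_gstr f \<Longrightarrow> gsat (lines z) e \<phi> \<longleftrightarrow> gsat int_gstr f \<phi>"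
        using gsat_agree[OF zg zgroup_int, of \<phi>] by blast
      \<comment> \<open>As A is finite, the eventual agreements on its atoms hold together from some
        index on; one such index at which the formula is also true suffices.\<close>
      have "\<forall>\<^sub>F i in sequentially. agree A (lines z) (\<lambda>_. (1, 0)) int_gstr (\<lambda>_. z i)"
        unfolding agree_def using holds_lines[OF lim decA] A(1) by (intro eventually_ball_finite) auto
      from eventually_happens[OF eventually_conj[OF this z[OF \<phi>]]] obtain i where
        "agree A (lines z) (\<lambda>_. (1, 0)) int_gstr (\<lambda>_. z i)" "gsat1 int_gstr (z i) \<phi>" by auto
      then show ?thesis using A(2)[of "\<lambda>_. (1, 0)" "\<lambda>_. z i"] X by (auto simp: gsat1_def)
    qed
    then show ?thesis using zg X by (auto simp: realizes_def)
  qed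
qed

end

theorem theorem3:
  shows
    "(\<forall>(M :: 'm gstr) t (S :: 'a tstr) (N :: 'n gstr) u (T :: 'b tstr).
        presburger_toag M t S \<and> presburger_toag N u T \<and>
        ((\<exists>k. penult M t = mult M k (one M)) \<longleftrightarrow> (\<exists>k. penult N u = mult N k (one N))) \<and>
        (\<forall>k l. penult M t = mult M k (one M) \<and> penult N u = mult N l (one N) \<longrightarrow> k = l) \<and>
        (\<forall>n>0. \<exists>r. has_remainder M (penult M t) n r \<and> has_remainder N (penult N u) n r)
        \<longrightarrow> elem_equiv S T) \<and>
     (\<forall>(M :: 'm gstr) t (S :: 'a tstr) (N :: 'n gstr) u (T :: 'b tstr).
        presburger_toag M t S \<and> presburger_toag N u T \<and>
        type_of M (penult M t) = type_of N (penult N u)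
        \<longrightarrow> elem_equiv S T) \<and>
     (\<forall>p. complete_1_type p \<and> Le GZero (GVar 0) \<in> p \<longrightarrow>
        (\<exists>(M :: nat gstr) t (S :: nat tstr).
           presburger_toag M t S \<and> realizes M (penult M t) p))"
proof (intro conjI allI impI; elim conjE)
  fix M :: "'m gstr" and t and S :: "'a tstr" and N :: "'n gstr" and u and T :: "'b tstr"
  assume S: "presburger_toag M t S" and T: "presburger_toag N u T"
    and "(\<exists>k. penult M t = mult M k (one M)) \<longleftrightarrow> (\<exists>k. penult N u = mult N k (one N))"
    and "\<forall>k l. penult M t = mult M k (one M) \<and> penult N u = mult N l (one N) \<longrightarrow> k = l"
    and "\<forall>n>0. \<exists>r. has_remainder M (penult M t) n r \<and> has_remainder N (penult N u) n r"
  then show "elem_equiv S T"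
    by (intro toag_elem_equiv[OF S T] remainders_holds[OF S T]) auto
next
  fix M :: "'m gstr" and t and S :: "'a tstr" and N :: "'n gstr" and u and T :: "'b tstr"
  assume S: "presburger_toag M t S" and T: "presburger_toag N u T"
    and eq: "type_of M (penult M t) = type_of N (penult N u)"
  have "gsat1 M (penult M t) (atom_fm \<alpha>) \<longleftrightarrow> gsat1 N (penult N u) (atom_fm \<alpha>)" for \<alpha>
    using eq atom_fm_fm1[of \<alpha>] unfolding type_of_def by blast
  then show "elem_equiv S T"
    by (intro toag_elem_equiv[OF S T]) (simp add: gsat1_atom_fm)
next
  fix p assume p: "complete_1_type p" "Le GZero (GVar 0) \<in> p"
  from type_realized[OF this] show "\<exists>(M :: nat gstr) t (S :: nat tstr).
      presburger_toag M t S \<and> realizes M (penult M t) p"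
    using toag_of_realization[OF zgroup_int _ p(2)] toag_of_realization[of "lines _", OF _ _ p(2)] by blast
qed

end
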